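(* There exists $n_0$ such that for every $n \ge n_0$ the following holds. Let $t=\frac{1}{4}n^{1/3}$ (rounded to an integer). Let $T_1,T_2,\dots,T_t$ be trees such that for each $i\in\{1,\dots,t\}$ we have $|T_i| = n-i+1$ and at least one of the following holds: (1) $T_i$ has a set of at most $n^{1/3}$ vertices such that the union of their neighborhoods contains at least $n^{2/3}$ leaves of $T_i$; (2) $T_i$ has at least $n^{2/3}$ independent leaves. Then $T_1,T_2,\dots,T_t$ pack into the complete graph $K_n$.
   Context: $|T|$ denotes the number of vertices of $T$. A set of graphs $G_1,\dots,G_m$ packs into a graph $H$ if $G_1,\dots,G_m$ can be found as pairwise edge-disjoint subgraphs of $H$. A leaf is a vertex of degree $1$. A set of leaves is independent if the neighbors of the leaves are pairwise distinct (i.e. the edges incident to these leaves form a matching). The neighborhood of a set $X$ of vertices is the set of vertices not in $X$ having a neighbor in $X$. The paper suppresses integer-part notation, so quantities such as $\frac14 n^{1/3}$ are understood as integers. *)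

theory Defs
  imports Complex_Main
begin

definition graph :: "nat set \<Rightarrow> nat set set \<Rightarrow> bool" where
  "graph V E \<longleftrightarrow> finite V \<and> (\<forall>e\<in>E. \<exists>u v. e = {u, v} \<and> u \<noteq> v \<and> u \<in> V \<and> v \<in> V)"

definition connected_graph :: "nat set \<Rightarrow> nat set set \<Rightarrow> bool" where
  "connected_graph V E \<longleftrightarrow>
     (\<forall>u\<in>V. \<forall>v\<in>V. (\<lambda>x y. {x, y} \<in> E)\<^sup>*\<^sup>* u v)"

definition has_cycle :: "nat set \<Rightarrow> nat set set \<Rightarrow> bool" where
  "has_cycle V E \<longleftrightarrow>
     (\<exists>cs. length cs \<ge> 3 \<and> distinct cs \<and> set cs \<subseteq> V \<and>
       (\<forall>i < length cs. {cs ! i, cs ! ((i + 1) mod length cs)} \<in> E))"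

definition tree :: "nat set \<Rightarrow> nat set set \<Rightarrow> bool" where
  "tree V E \<longleftrightarrow> graph V E \<and> V \<noteq> {} \<and> connected_graph V E \<and> \<not> has_cycle V E"

definition degree :: "nat set set \<Rightarrow> nat \<Rightarrow> nat" where
  "degree E v = card {u. {u, v} \<in> E}"

definition leaf :: "nat set \<Rightarrow> nat set set \<Rightarrow> nat \<Rightarrow> bool" where
  "leaf V E v \<longleftrightarrow> v \<in> V \<and> degree E v = 1"

definition independent_leaves :: "nat set \<Rightarrow> nat set set \<Rightarrow> nat set \<Rightarrow> bool" where
  "independent_leaves V E L \<longleftrightarrow> (\<forall>x\<in>L. leaf V E x) \<and>
     (\<forall>x\<in>L. \<forall>y\<in>L. \<forall>a b. x \<noteq> y \<and> {x, a} \<in> E \<and> {y, b} \<in> E \<longrightarrow> {x, a} \<inter> {y, b} = {})"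

definition nbhd_union :: "nat set set \<Rightarrow> nat set \<Rightarrow> nat set" where
  "nbhd_union E S = {v. \<exists>u\<in>S. {u, v} \<in> E}"

definition cond1 :: "nat \<Rightarrow> nat set \<Rightarrow> nat set set \<Rightarrow> bool" where
  "cond1 n V E \<longleftrightarrow> (\<exists>S \<subseteq> V. real (card S) \<le> real n powr (1/3) \<and>
      real (card {v \<in> nbhd_union E S. leaf V E v}) \<ge> real n powr (2/3))"

definition cond2 :: "nat \<Rightarrow> nat set \<Rightarrow> nat set set \<Rightarrow> bool" where
  "cond2 n V E \<longleftrightarrow> (\<exists>L. independent_leaves V E L \<and> real (card L) \<ge> real n powr (2/3))"

definition packs_into_K :: "nat \<Rightarrow> (nat \<Rightarrow> nat set \<times> nat set set) \<Rightarrow> nat set \<Rightarrow> bool" where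
  "packs_into_K n T I \<longleftrightarrow> (\<exists>f :: nat \<Rightarrow> nat \<Rightarrow> nat.
      (\<forall>i\<in>I. inj_on (f i) (fst (T i)) \<and> f i ` fst (T i) \<subseteq> {..<n}) \<and>
      (\<forall>i\<in>I. \<forall>j\<in>I. i \<noteq> j \<longrightarrow>
          (image (f i) ` snd (T i)) \<inter> (image (f j) ` snd (T j)) = {}))"

end

theory Submission
  imports Defs "HOL-Real_Asymp.Real_Asymp" "HOL-Combinatorics.Transposition"
begin

text \<open>
  The trees are embedded in the order \<open>T\<^sub>1, \<dots>, T\<^sub>t\<close>, and the vertices \<open>1, \<dots>, t\<close> of \<open>K\<^sub>n\<close> are
  reserved as hubs. Let \<open>G\<close> be the union of the trees embedded before \<open>T\<^sub>i\<close>. All of them have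
  placed only leaves on \<open>i, \<dots>, t\<close>, so \<open>i\<close> has at most \<open>i - 1\<close> neighbours in \<open>G\<close>, and \<open>T\<^sub>i\<close>, which
  has \<open>n - i + 1\<close> vertices, can leave all of them out: every edge at \<open>i\<close> becomes available for a
  chosen vertex \<open>v\<close> of \<open>T\<^sub>i\<close>. If \<open>v\<close> has many leaves, the hubs \<open>i + 1, \<dots>, t\<close> receive some of these,
  so that all later trees leave out the vertex \<open>i\<close>; otherwise \<open>v\<close> has degree about \<open>n/2\<close> at most.
  Hence no vertex that must be covered has \<open>G\<close>-degree much larger than \<open>n/2\<close>.

  To embed \<open>T\<^sub>i - v\<close>, choose an independent set \<open>M\<close> of about \<open>n/6\<close> vertices of degree at most 2 and
  embed the rest greedily on vertices of \<open>G\<close>-degree \<open>O(t)\<close>, treating the at most \<open>O(\<surd>n)\<close> vertices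
  of degree above \<open>\<surd>n\<close> first. A vertex of \<open>M\<close> then excludes only \<open>O(t)\<close> of the remaining
  positions, so \<open>M\<close> can be placed by a transposition argument once every position admits more
  than \<open>O(t)\<close> vertices of \<open>M\<close>. This is clear if \<open>v\<close> has that many leaves. If no vertex has that many,
  then either hypothesis on \<open>T\<^sub>i\<close> provides many vertices adjacent to leaves; these are embedded
  before everything else, spread out so that every position is nonadjacent to enough of them.
\<close>

section \<open>Degrees in graphs and trees\<close>

definition nbr :: "nat set set \<Rightarrow> nat \<Rightarrow> nat set" where
  "nbr E v = {u. {u, v} \<in> E}"

lemma degree_nbr: "degree E v = card (nbr E v)"
  by (simp add: degree_def nbr_def)

lemma nbr_sym: "u \<in> nbr E v \<longleftrightarrow> v \<in> nbr E u"
  by (simp add: nbr_def insert_commute)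

lemma graph_no_loop: "graph V E \<Longrightarrow> {u} \<notin> E"
  unfolding graph_def by (metis doubleton_eq_iff insert_absorb2)

lemma graph_nbr_subset: "graph V E \<Longrightarrow> nbr E v \<subseteq> V"
  unfolding graph_def nbr_def by (auto simp: doubleton_eq_iff)

lemma graph_finite_nbr: "graph V E \<Longrightarrow> finite (nbr E v)"
  using graph_nbr_subset[of V E v] by (auto simp: graph_def intro: finite_subset)

lemma graph_finite_edges: "graph V E \<Longrightarrow> finite E"
  unfolding graph_def by (rule finite_subset[of _ "Pow V"]) auto

lemma degree_eq_card_incident:
  assumes "graph V E" shows "degree E v = card {e \<in> E. v \<in> e}"
proof -
  have "bij_betw (\<lambda>u. {u, v}) (nbr E v) {e \<in> E. v \<in> e}"
    unfolding bij_betw_def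
  proof
    show "inj_on (\<lambda>u. {u, v}) (nbr E v)"
      by (auto simp: inj_on_def doubleton_eq_iff)
    show "(\<lambda>u. {u, v}) ` nbr E v = {e \<in> E. v \<in> e}"
    proof safe
      fix e assume e: "e \<in> E" "v \<in> e"
      then obtain a b where "e = {a, b}" using assms by (auto simp: graph_def)
      with e have "\<exists>u. e = {u, v}" by (auto simp: insert_commute)
      then show "e \<in> (\<lambda>u. {u, v}) ` nbr E v" using e by (auto simp: nbr_def)
    qed (auto simp: nbr_def)
  qed
  then show ?thesis by (simp add: degree_nbr bij_betw_same_card)
qed

lemma handshake:
  assumes "graph V E" shows "(\<Sum>v\<in>V. degree E v) = 2 * card E"
proof -
  have fV: "finite V" and fE: "finite E"
    using assms graph_finite_edges by (auto simp: graph_def)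
  have "(\<Sum>v\<in>V. degree E v) = (\<Sum>v\<in>V. \<Sum>e\<in>E. if v \<in> e then 1 else 0)"
    using fE by (simp add: degree_eq_card_incident[OF assms] sum.If_cases Int_def)
  also have "\<dots> = (\<Sum>e\<in>E. \<Sum>v\<in>V. if v \<in> e then 1 else 0)"
    by (rule sum.swap)
  also have "\<dots> = (\<Sum>e\<in>E. 2)"
  proof (rule sum.cong[OF refl])
    fix e assume "e \<in> E"
    then obtain a b where e: "e = {a, b}" "a \<noteq> b" "a \<in> V" "b \<in> V"
      using assms by (auto simp: graph_def)
    have "V \<inter> {v. v \<in> e} = {a, b}" using e by auto
    then show "(\<Sum>v\<in>V. if v \<in> e then 1 else 0) = (2::nat)"
      using fV e by (simp add: sum.If_cases)
  qed
  finally show ?thesis by simp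
qed

text \<open>All neighbours of the first vertex of a longest path lie on the path. One of them
  differs from the second vertex of the path and closes a cycle of length at least 3.\<close>

lemma min_degree_two_has_cycle:
  assumes g: "graph V E" and ne: "V \<noteq> {}" and deg: "\<And>v. v \<in> V \<Longrightarrow> degree E v \<ge> 2"
  shows "has_cycle V E"
proof -
  define path where "path ps \<longleftrightarrow> ps \<noteq> [] \<and> distinct ps \<and> set ps \<subseteq> V \<and>
     (\<forall>i. Suc i < length ps \<longrightarrow> {ps ! i, ps ! Suc i} \<in> E)" for ps
  have fV: "finite V" using g by (simp add: graph_def)
  obtain x0 where "x0 \<in> V" using ne by auto
  then have p0: "path [x0]" by (simp add: path_def)
  have bound: "length ps \<le> card V" if "path ps" for ps
    using that fV by (metis path_def card_mono distinct_card)
  obtain ps where ps: "path ps" and max: "\<And>qs. path qs \<Longrightarrow> length qs \<le> length ps"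
  proof -
    let ?m = "Max (length ` {ps. path ps})"
    have fin: "finite (length ` {ps. path ps})"
      by (rule finite_subset[of _ "{..card V}"]) (use bound in auto)
    have "?m \<in> length ` {ps. path ps}" using p0 by (intro Max_in[OF fin]) auto
    then obtain ps where "path ps" "length ps = ?m" by auto
    then show thesis using that Max_ge[OF fin] by auto
  qed
  obtain x rest where px: "ps = x # rest" using ps by (cases ps) (auto simp: path_def)
  have xV: "x \<in> V" using ps px by (auto simp: path_def)
  \<comment> \<open>For a one-vertex path \<open>rest ! 0\<close> is an unspecified number. This is
    harmless: excluding any single number from at least two neighbours leaves some \<open>z\<close>,
    and \<open>z\<close> is then located on the path.\<close>
  have "\<not> (nbr E x \<subseteq> {rest ! 0})"
    using deg[OF xV] card_mono[of "{rest ! 0}" "nbr E x"] by (auto simp: degree_nbr)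
  then obtain z where z: "z \<in> nbr E x" "z \<noteq> rest ! 0" by auto
  have zV: "z \<in> V" using z graph_nbr_subset[OF g] by auto
  have zx: "z \<noteq> x" using z graph_no_loop[OF g, of x] by (auto simp: nbr_def)
  have "z \<in> set ps"
  proof (rule ccontr)
    assume "z \<notin> set ps"
    moreover have "{(z # ps) ! i, (z # ps) ! Suc i} \<in> E" if "Suc i < length (z # ps)" for i
      using that ps z px by (cases i) (auto simp: path_def nbr_def)
    ultimately have "path (z # ps)"
      using ps zV by (auto simp: path_def)
    then show False using max by fastforce
  qed
  then obtain k where k: "k < length ps" "ps ! k = z" by (auto simp: in_set_conv_nth)
  have k2: "k \<ge> 2"
  proof (rule ccontr)
    assume "\<not> k \<ge> 2"
    then have "k = 0 \<or> k = 1" by auto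
    then show False using k px zx z by auto
  qed
  define cs where "cs = take (Suc k) ps"
  have len: "length cs = Suc k" using k by (simp add: cs_def)
  have nth: "cs ! i = ps ! i" if "i \<le> k" for i using that by (simp add: cs_def)
  have "{cs ! i, cs ! ((i + 1) mod length cs)} \<in> E" if "i < length cs" for i
  proof (cases "i = k")
    case True
    then show ?thesis using k px z nth[of k] nth[of 0] by (simp add: len nbr_def)
  next
    case False
    then show ?thesis using that ps k nth[of i] nth[of "Suc i"] by (simp add: len path_def)
  qed
  moreover have "distinct cs" "set cs \<subseteq> V"
    using ps set_take_subset[of "Suc k" ps] by (auto simp: cs_def path_def)
  ultimately show ?thesis unfolding has_cycle_def using len k2 by (intro exI[of _ cs]) auto
qed

text \<open>Deleting a vertex of degree at most 1, which exists since there is no cycle, removes at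
  most one edge. The induction runs over forests, so connectedness need not survive the
  deletion.\<close>

lemma acyclic_card_edges:
  assumes "graph V E" "V \<noteq> {}" "\<not> has_cycle V E" shows "card E + 1 \<le> card V"
  using assms
proof (induction "card V" arbitrary: V E)
  case 0
  then show ?case by (auto simp: graph_def)
next
  case (Suc k)
  have fV: "finite V" and fE: "finite E"
    using Suc.prems graph_finite_edges by (auto simp: graph_def)
  obtain v where v: "v \<in> V" "degree E v \<le> 1"
    using min_degree_two_has_cycle[OF Suc.prems(1,2)] Suc.prems(3) by fastforce
  let ?E = "{e \<in> E. v \<notin> e}" and ?V = "V - {v}"
  have split: "card E = card ?E + card {e \<in> E. v \<in> e}"
    using fE by (subst card_Un_disjoint[symmetric]) (auto intro: arg_cong[of _ _ card])
  have g: "graph ?V ?E" using Suc.prems(1) unfolding graph_def by auto blast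
  show ?case
  proof (cases "?V = {}")
    case True
    then have "?E = {}" using g by (auto simp: graph_def)
    moreover have "{e \<in> E. v \<in> e} = {}"
    proof -
      have "False" if e: "e \<in> E" for e
      proof -
        obtain a b where "a \<noteq> b" "a \<in> V" "b \<in> V" using Suc.prems(1) e by (auto simp: graph_def)
        then show False using True by blast
      qed
      then show ?thesis by auto
    qed
    ultimately show ?thesis using split Suc.hyps(2) by simp
  next
    case False
    have nc: "\<not> has_cycle ?V ?E" using Suc.prems(3) unfolding has_cycle_def by blast
    have "card ?E + 1 \<le> card ?V"
      using Suc.hyps(1)[OF _ g False nc] Suc.hyps(2) v(1) fV by simp
    then show ?thesis
      using split v fV Suc.hyps(2) degree_eq_card_incident[OF Suc.prems(1), of v] by simp
  qed
qed

section \<open>Degree sums, connectedness and leaves of trees\<close>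

lemma tree_degree_sum:
  assumes "tree V E" shows "(\<Sum>v\<in>V. degree E v) + 2 \<le> 2 * card V"
  using assms acyclic_card_edges[of V E] handshake[of V E] by (auto simp: tree_def)

lemma tree_closed_subset:
  assumes t: "tree V E" and v: "v \<in> A" "A \<subseteq> V" and cl: "\<And>x. x \<in> A \<Longrightarrow> nbr E x \<subseteq> A"
  shows "A = V"
proof -
  have "y \<in> A" if "(\<lambda>x y. {x, y} \<in> E)\<^sup>*\<^sup>* v y" for y
    using that
  proof induction
    case (step y z)
    then show ?case using cl[of y] by (auto simp: nbr_def insert_commute)
  qed (rule v)
  then show ?thesis using t v by (auto simp: tree_def connected_graph_def)
qed

lemma tree_degree_pos:
  assumes t: "tree V E" and "card V \<ge> 2" "v \<in> V" shows "degree E v \<ge> 1"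
proof (rule ccontr)
  assume "\<not> degree E v \<ge> 1"
  then have "nbr E v = {}" using t graph_finite_nbr[of V E v] by (simp add: degree_nbr tree_def Suc_le_eq card_gt_0_iff)
  then have "{v} = V" using tree_closed_subset[OF t, of v "{v}"] assms by auto
  then show False using assms by auto
qed

lemma leaf_nbr_singleton:
  assumes "leaf V E x" obtains p where "nbr E x = {p}"
  using assms by (auto simp: leaf_def degree_nbr card_1_singleton_iff)

text \<open>Two adjacent leaves would form a connected component of their own.\<close>

lemma tree_leaves_nonadjacent:
  assumes t: "tree V E" and c: "card V \<ge> 3" and x: "leaf V E x" and y: "leaf V E y"
  shows "{x, y} \<notin> E"
proof
  assume e: "{x, y} \<in> E"
  obtain p q where "nbr E x = {p}" "nbr E y = {q}" using x y leaf_nbr_singleton by meson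
  then have "nbr E x = {y}" "nbr E y = {x}" using e by (auto simp: nbr_def insert_commute)
  then have "{x, y} = V" using tree_closed_subset[OF t, of x "{x, y}"] x y by (auto simp: leaf_def)
  then have "card V \<le> 2" using card_insert_le_m1[of 2 "{y}" x] by auto
  then show False using c by simp
qed

section \<open>Extending partial embeddings\<close>

text \<open>With \<open>G\<close> the edges used by earlier trees, this is an embedding of the part
  of the tree on \<open>X\<close> into the complement of \<open>G\<close>.\<close>

definition emb :: "nat set set \<Rightarrow> nat set set \<Rightarrow> nat set \<Rightarrow> (nat \<Rightarrow> nat) \<Rightarrow> bool" where
  "emb E G X f \<longleftrightarrow> inj_on f X \<and> (\<forall>a\<in>X. \<forall>b\<in>X. {a, b} \<in> E \<longrightarrow> {f a, f b} \<notin> G)"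

lemma emb_insert:
  assumes "emb E G X f" "u \<notin> X" "x \<notin> f ` X" "{u} \<notin> E"
    and "\<And>a. a \<in> X \<Longrightarrow> {a, u} \<in> E \<Longrightarrow> {f a, x} \<notin> G"
  shows "emb E G (insert u X) (f(u := x))"
  using assms unfolding emb_def
  by (auto simp: inj_on_def insert_commute fun_upd_def image_iff)

text \<open>A new vertex must avoid the used positions and the \<open>G\<close>-neighbourhoods of
  the images of its already placed tree neighbours. There are at most \<open>b\<close> such
  neighbours, and all images stay in \<open>A\<close>, where degrees are at most \<open>d\<close>;
  so at most \<open>b * d\<close> further positions are excluded.\<close>

lemma greedy_extension:
  assumes gG: "graph V G" and loop: "\<And>u. {u} \<notin> E"
    and "finite U" "finite X" "X \<inter> U = {}" "finite A"
    and "emb E G X f" "f ` X \<subseteq> A" and deg: "\<And>x. x \<in> A \<Longrightarrow> degree G x \<le> d"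
    and "\<And>u. u \<in> U \<Longrightarrow> card (nbr E u \<inter> (X \<union> U)) \<le> b"
    and "card X + card U + b * d \<le> card A"
  shows "\<exists>f'. emb E G (X \<union> U) f' \<and> (\<forall>x\<in>X. f' x = f x) \<and> f' ` (X \<union> U) \<subseteq> A"
  using assms(3-8,10,11)
proof (induction U)
  case empty
  then show ?case by auto
next
  case (insert u U)
  have "card (nbr E w \<inter> (X \<union> U)) \<le> b" if "w \<in> U" for w
    using insert.prems(6)[of w] that card_mono[of "nbr E w \<inter> (X \<union> insert u U)" "nbr E w \<inter> (X \<union> U)"]
      insert.prems(1) insert.hyps(1) by fastforce
  then obtain f1 where f1: "emb E G (X \<union> U) f1" "\<forall>x\<in>X. f1 x = f x" "f1 ` (X \<union> U) \<subseteq> A"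
    using insert.IH insert.prems insert.hyps by auto
  let ?N = "nbr E u \<inter> (X \<union> U)"
  let ?F = "f1 ` (X \<union> U) \<union> (\<Union>a\<in>?N. nbr G (f1 a))"
  have finXU: "finite (X \<union> U)" using insert by auto
  have cN: "card ?N \<le> b"
    using insert.prems(6)[of u] card_mono[of "nbr E u \<inter> (X \<union> insert u U)" ?N] finXU by fastforce
  have "card (\<Union>a\<in>?N. nbr G (f1 a)) \<le> (\<Sum>a\<in>?N. card (nbr G (f1 a)))"
    using finXU by (intro card_UN_le) auto
  also have "\<dots> \<le> (\<Sum>a\<in>?N. d)"
    using f1(3) deg by (intro sum_mono) (auto simp: degree_nbr[symmetric])
  also have "\<dots> \<le> b * d" using cN by simp
  finally have c1: "card (\<Union>a\<in>?N. nbr G (f1 a)) \<le> b * d" .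
  have "card ?F \<le> card (f1 ` (X \<union> U)) + card (\<Union>a\<in>?N. nbr G (f1 a))" by (rule card_Un_le)
  also have "\<dots> \<le> card X + card U + b * d"
    using c1 card_image_le[OF finXU, of f1] card_Un_le[of X U] by linarith
  also have "\<dots> < card A" using insert.prems insert.hyps by simp
  finally have "card ?F < card A" .
  moreover have "finite ?F" using finXU graph_finite_nbr[OF gG] by auto
  ultimately obtain x where x: "x \<in> A" "x \<notin> ?F"
    by (metis card_mono linorder_not_less subsetI)
  have "emb E G (insert u (X \<union> U)) (f1(u := x))"
  proof (rule emb_insert[OF f1(1)])
    show "u \<notin> X \<union> U" using insert by auto
    show "x \<notin> f1 ` (X \<union> U)" using x by auto
    show "{f1 a, x} \<notin> G" if "a \<in> X \<union> U" "{a, u} \<in> E" for a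
      using x that by (auto simp: nbr_def insert_commute)
  qed (rule loop)
  moreover have "\<forall>z\<in>X. (f1(u := x)) z = f z" "(f1(u := x)) ` (X \<union> insert u U) \<subseteq> A"
    using f1(2,3) x(1) insert.prems(2) insert.hyps by auto
  ultimately show ?case unfolding Un_insert_right by blast
qed

text \<open>Placing the vertices of \<open>P\<close> one at a time, some candidate position misses the
  neighbourhoods of a third of the total weight, where a vertex \<open>y\<close> that has been missed \<open>k\<close>
  times has weight \<open>2\<^sup>-\<^sup>k\<close>; the total weight then drops by a factor \<open>5/6\<close>.\<close>

lemma diversified_extension:
  assumes gG: "graph V G" and loop: "\<And>u. {u} \<notin> E"
    and "finite P" "finite X" "X \<inter> P = {}" "finite A" and fY: "finite Y"
    and "emb E G X f" "f ` X \<subseteq> A" and deg: "\<And>x. x \<in> A \<Longrightarrow> degree G x \<le> d"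
    and "\<And>y. y \<in> Y \<Longrightarrow> 3 * degree G y + 2 * (card X + card P) * (d + 1) \<le> 2 * card A"
    and "(card X + card P) * (d + 1) < card A"
  shows "\<exists>f'. emb E G (X \<union> P) f' \<and> (\<forall>x\<in>X. f' x = f x) \<and> f' ` (X \<union> P) \<subseteq> A \<and>
     (\<Sum>y\<in>Y. (1/2) ^ card {p\<in>P. {f' p, y} \<notin> G}) \<le> (5/6) ^ card P * real (card Y)"
  using assms(3-6,8,9,11,12)
proof (induction P)
  case empty
  then show ?case by auto
next
  case (insert u U)
  have "\<exists>f'. emb E G (X \<union> U) f' \<and> (\<forall>x\<in>X. f' x = f x) \<and> f' ` (X \<union> U) \<subseteq> A \<and>
     (\<Sum>y\<in>Y. (1/2) ^ card {p\<in>U. {f' p, y} \<notin> G}) \<le> (5/6) ^ card U * real (card Y)"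
  proof (rule insert.IH)
    fix y assume "y \<in> Y"
    then show "3 * degree G y + 2 * (card X + card U) * (d + 1) \<le> 2 * card A"
      using insert.prems(6)[of y] insert.hyps by auto
  qed (use insert.prems insert.hyps in auto)
  then obtain f1 where f1: "emb E G (X \<union> U) f1" "\<forall>x\<in>X. f1 x = f x" "f1 ` (X \<union> U) \<subseteq> A"
    and w: "(\<Sum>y\<in>Y. (1/2) ^ card {p\<in>U. {f1 p, y} \<notin> G}) \<le> (5/6) ^ card U * real (card Y)"
    by blast
  define wt :: "nat \<Rightarrow> real" where "wt y = (1/2) ^ card {p\<in>U. {f1 p, y} \<notin> G}" for y
  \<comment> \<open>The neighbourhoods of all placed vertices are discarded, not only those of the
    tree neighbours of \<open>u\<close>; the sets \<open>X\<close> and \<open>P\<close> are small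
    enough for this.\<close>
  let ?F = "f1 ` (X \<union> U) \<union> (\<Union>a\<in>X \<union> U. nbr G (f1 a))"
  define B where "B = A - ?F"
  have finXU: "finite (X \<union> U)" using insert by auto
  have "card (\<Union>a\<in>X \<union> U. nbr G (f1 a)) \<le> (\<Sum>a\<in>X \<union> U. card (nbr G (f1 a)))"
    using finXU by (intro card_UN_le) auto
  also have "\<dots> \<le> (\<Sum>a\<in>X \<union> U. d)"
    using f1(3) deg by (intro sum_mono) (auto simp: degree_nbr[symmetric])
  finally have c1: "card (\<Union>a\<in>X \<union> U. nbr G (f1 a)) \<le> card (X \<union> U) * d" by simp
  have "card ?F \<le> card (f1 ` (X \<union> U)) + card (\<Union>a\<in>X \<union> U. nbr G (f1 a))" by (rule card_Un_le)
  also have "\<dots> \<le> card (X \<union> U) * (d + 1)"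
    using c1 card_image_le[OF finXU, of f1] by simp
  also have "\<dots> \<le> (card X + card (insert u U)) * (d + 1)"
    using card_Un_le[of X U] insert.hyps by (intro mult_le_mono1) simp
  finally have cF: "card ?F \<le> (card X + card (insert u U)) * (d + 1)" .
  have finF: "finite ?F" using finXU graph_finite_nbr[OF gG] by auto
  have finB: "finite B" using insert.prems by (simp add: B_def)
  have cB: "card A \<le> card B + (card X + card (insert u U)) * (d + 1)"
    using cF diff_card_le_card_Diff[OF finF, of A] by (simp add: B_def)
  then have Bpos: "card B > 0" using insert.prems(7) by linarith
  have third: "real (card B) / 3 \<le> real (card {x\<in>B. {x, y} \<notin> G})" if "y \<in> Y" for y
  proof -
    have "B - nbr G y = {x\<in>B. {x, y} \<notin> G}" by (auto simp: nbr_def)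
    then have "card B - degree G y \<le> card {x\<in>B. {x, y} \<notin> G}"
      using diff_card_le_card_Diff[OF graph_finite_nbr[OF gG], of B y] by (simp add: degree_nbr)
    moreover have "3 * degree G y \<le> 2 * card B"
      using insert.prems(6)[OF that] cB by linarith
    ultimately have "card B \<le> 3 * card {x\<in>B. {x, y} \<notin> G}" by linarith
    then show ?thesis by linarith
  qed
  \<comment> \<open>Averaging: each \<open>y\<close> is nonadjacent to at least a third of
    \<open>B\<close>, so after exchanging the sums an average position of \<open>B\<close> misses a
    third of the total weight.\<close>
  have "\<exists>x\<in>B. (\<Sum>y\<in>Y. wt y) / 3 \<le> (\<Sum>y\<in>Y. if {x, y} \<notin> G then wt y else 0)"
  proof (rule ccontr)
    assume "\<not> ?thesis"
    then have "(\<Sum>x\<in>B. \<Sum>y\<in>Y. if {x, y} \<notin> G then wt y else 0) < (\<Sum>x\<in>B. (\<Sum>y\<in>Y. wt y) / 3)"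
      using finB Bpos by (intro sum_strict_mono) (auto simp: not_le)
    also have "\<dots> = (\<Sum>y\<in>Y. real (card B) / 3 * wt y)"
      by (simp only: sum_constant sum_distrib_left[symmetric])
    also have "\<dots> \<le> (\<Sum>y\<in>Y. real (card {x\<in>B. {x, y} \<notin> G}) * wt y)"
      by (intro sum_mono mult_right_mono third) (simp_all add: wt_def)
    also have "\<dots> = (\<Sum>y\<in>Y. \<Sum>x\<in>B. if {x, y} \<notin> G then wt y else 0)"
      by (intro sum.cong refl) (simp only: sum.If_cases[OF finB] Int_def mem_Collect_eq sum_constant sum.neutral_const add_0_right)
    also have "\<dots> = (\<Sum>x\<in>B. \<Sum>y\<in>Y. if {x, y} \<notin> G then wt y else 0)" by (rule sum.swap)
    finally show False by simp
  qed
  then obtain x where x: "x \<in> B"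
    and x3: "(\<Sum>y\<in>Y. wt y) / 3 \<le> (\<Sum>y\<in>Y. if {x, y} \<notin> G then wt y else 0)" by blast
  let ?f = "f1(u := x)"
  have uU: "u \<notin> X \<union> U" using insert by auto
  have e: "emb E G (insert u (X \<union> U)) ?f"
  proof (rule emb_insert[OF f1(1) uU])
    show "x \<notin> f1 ` (X \<union> U)" using x by (auto simp: B_def)
    show "{f1 a, x} \<notin> G" if "a \<in> X \<union> U" "{a, u} \<in> E" for a
      using x that by (auto simp: nbr_def insert_commute B_def)
  qed (rule loop)
  have "(\<Sum>y\<in>Y. (1/2) ^ card {p\<in>insert u U. {?f p, y} \<notin> G})
      = (\<Sum>y\<in>Y. wt y - (if {x, y} \<notin> G then wt y else 0) / 2)"
  proof (rule sum.cong[OF refl])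
    fix y
    have "{p\<in>insert u U. {?f p, y} \<notin> G} =
      (if {x, y} \<notin> G then insert u {p\<in>U. {f1 p, y} \<notin> G} else {p\<in>U. {f1 p, y} \<notin> G})"
      using uU by auto
    then show "(1/2) ^ card {p\<in>insert u U. {?f p, y} \<notin> G}
        = wt y - (if {x, y} \<notin> G then wt y else 0) / 2"
      using insert.hyps by (simp add: wt_def)
  qed
  also have "\<dots> = (\<Sum>y\<in>Y. wt y) - (\<Sum>y\<in>Y. if {x, y} \<notin> G then wt y else 0) / 2"
    by (simp only: sum_subtractf sum_divide_distrib[symmetric])
  also have "\<dots> \<le> 5/6 * (\<Sum>y\<in>Y. wt y)" using x3 by simp
  also have "\<dots> \<le> 5/6 * ((5/6) ^ card U * real (card Y))"
    using w unfolding wt_def by (intro mult_left_mono) auto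
  finally have "(\<Sum>y\<in>Y. (1/2) ^ card {p\<in>insert u U. {?f p, y} \<notin> G})
      \<le> (5/6) ^ card (insert u U) * real (card Y)"
    using insert.hyps by simp
  moreover have "x \<in> A" using x by (simp add: B_def)
  then have "?f ` insert u (X \<union> U) \<subseteq> A" using f1(3) by auto
  moreover have "\<forall>z\<in>X. ?f z = f z" using f1(2) uU by auto
  ultimately show ?case using e unfolding Un_insert_right by (intro exI[of _ ?f] conjI)
qed
text \<open>A bijection with the fewest forbidden pairs has none: a forbidden pair could be repaired
  by a transposition.\<close>

lemma bijection_avoiding_forbidden_pairs:
  assumes M: "finite M" and R: "finite R" and MR: "card M = card R"
    and few: "\<And>w. w \<in> M \<Longrightarrow> card {y\<in>R. \<not> ok w y} \<le> b"
    and many: "\<And>y. y \<in> R \<Longrightarrow> card {w\<in>M. ok w y} > b"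
  shows "\<exists>g. bij_betw g M R \<and> (\<forall>w\<in>M. ok w (g w))"
proof -
  define bad where "bad g = card {w\<in>M. \<not> ok w (g w)}" for g
  obtain g0 where "bij_betw g0 M R" using finite_same_card_bij[OF M R MR] by blast
  then obtain g where g: "bij_betw g M R" and min: "\<And>h. bij_betw h M R \<Longrightarrow> bad g \<le> bad h"
    using ex_has_least_nat[of "\<lambda>g. bij_betw g M R" g0 bad] by blast
  have "ok w (g w)" if w: "w \<in> M" for w
  proof (rule ccontr)
    assume nok: "\<not> ok w (g w)"
    have gw: "g w \<in> R" using g w by (auto simp: bij_betw_def)
    have inj: "inj_on g M" using g by (simp add: bij_betw_def)
    \<comment> \<open>More than \<open>b\<close> positions are occupied by partners that tolerate
      \<open>g w\<close>, while at most \<open>b\<close> positions are forbidden for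
      \<open>w\<close>. Some partner \<open>z\<close> can therefore trade places with
      \<open>w\<close> without creating a forbidden pair.\<close>
    have "card (g ` {z\<in>M. ok z (g w)}) = card {z\<in>M. ok z (g w)}"
      using inj by (intro card_image) (auto intro: inj_on_subset)
    then have "card {y\<in>R. \<not> ok w y} < card (g ` {z\<in>M. ok z (g w)})"
      using few[OF w] many[OF gw] by linarith
    then have "\<not> g ` {z\<in>M. ok z (g w)} \<subseteq> {y\<in>R. \<not> ok w y}"
      using card_mono[of "{y\<in>R. \<not> ok w y}" "g ` {z\<in>M. ok z (g w)}"] R by auto
    then obtain z where z: "z \<in> M" "ok z (g w)" "ok w (g z)"
      using g by (auto simp: bij_betw_def)
    let ?h = "g \<circ> transpose w z"
    have "bij_betw (transpose w z) M M"
      using w z by simp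
    then have h: "bij_betw ?h M R" using g by (rule bij_betw_trans)
    have "{x\<in>M. \<not> ok x (?h x)} \<subseteq> {x\<in>M. \<not> ok x (g x)} - {w}"
    proof
      fix x assume x: "x \<in> {x\<in>M. \<not> ok x (?h x)}"
      then have "x \<noteq> w" "x \<noteq> z" using z by auto
      then show "x \<in> {x\<in>M. \<not> ok x (g x)} - {w}" using x by simp
    qed
    then have "{x\<in>M. \<not> ok x (?h x)} \<subset> {x\<in>M. \<not> ok x (g x)}" using w nok by blast
    then have "bad ?h < bad g" using M unfolding bad_def by (intro psubset_card_mono) auto
    then show False using min[OF h] by simp
  qed
  then show ?thesis using g by blast
qed

text \<open>A maximal independent set containing \<open>L\<close> dominates \<open>B\<close>, and
  each of its vertices accounts for at most three vertices: itself and two neighbours.\<close>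

lemma large_independent_superset:
  assumes gE: "graph V E" and B: "finite B" "\<And>u. u \<in> B \<Longrightarrow> degree E u \<le> 2"
    and L: "L \<subseteq> B" "\<And>a b. a \<in> L \<Longrightarrow> b \<in> L \<Longrightarrow> {a, b} \<notin> E"
  shows "\<exists>M. L \<subseteq> M \<and> M \<subseteq> B \<and> (\<forall>a\<in>M. \<forall>b\<in>M. {a, b} \<notin> E) \<and> card B \<le> 3 * card M"
proof -
  define I where "I = {M. L \<subseteq> M \<and> M \<subseteq> B \<and> (\<forall>a\<in>M. \<forall>b\<in>M. {a, b} \<notin> E)}"
  have "finite I" by (rule finite_subset[of _ "Pow B"]) (use B in \<open>auto simp: I_def\<close>)
  moreover have "L \<in> I" using L by (auto simp: I_def)
  ultimately obtain M where M: "M \<in> I" and max: "\<forall>S\<in>I. M \<subseteq> S \<longrightarrow> M = S"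
    by (metis finite_has_maximal empty_iff)
  have MB: "M \<subseteq> B" and fM: "finite M" using M B by (auto simp: I_def intro: finite_subset)
  have "B \<subseteq> M \<union> (\<Union>u\<in>M. nbr E u)"
  proof
    fix w assume w: "w \<in> B"
    show "w \<in> M \<union> (\<Union>u\<in>M. nbr E u)"
    proof (rule ccontr)
      assume n: "\<not> ?thesis"
      then have "insert w M \<in> I"
        using M w graph_no_loop[OF gE, of w] by (auto simp: I_def nbr_def insert_commute)
      then show False using max n by blast
    qed
  qed
  then have "card B \<le> card (M \<union> (\<Union>u\<in>M. nbr E u))"
    using fM graph_finite_nbr[OF gE] by (intro card_mono) auto
  also have "\<dots> \<le> card M + card (\<Union>u\<in>M. nbr E u)" by (rule card_Un_le)
  also have "card (\<Union>u\<in>M. nbr E u) \<le> (\<Sum>u\<in>M. card (nbr E u))"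
    using fM by (rule card_UN_le)
  also have "\<dots> \<le> (\<Sum>u\<in>M. 2)"
    using MB B by (intro sum_mono) (auto simp: degree_nbr[symmetric])
  finally have "card B \<le> 3 * card M" by simp
  then show ?thesis using M by (auto simp: I_def)
qed

section \<open>Spanning embeddings of a tree\<close>

text \<open>The degrees in \<open>G\<close> sum to at most \<open>2 * t * n\<close>, so at most
  \<open>n / 20\<close> vertices have degree above \<open>40 * t\<close>.\<close>

lemma card_low_degree:
  assumes gG: "graph {..<n} G" and W: "W \<subseteq> {..<n}" and Gsize: "card G \<le> t * n" and t1: "t \<ge> 1"
  shows "20 * card W \<le> 20 * card {x\<in>W. degree G x \<le> 40 * t} + n"
proof -
  let ?H = "{x\<in>W. \<not> degree G x \<le> 40 * t}"
  have fW: "finite W" using W finite_subset by blast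
  have "card ?H * (40 * t) = (\<Sum>x\<in>?H. 40 * t)" by simp
  also have "\<dots> \<le> (\<Sum>x\<in>?H. degree G x)" by (intro sum_mono) auto
  also have "\<dots> \<le> (\<Sum>x\<in>{..<n}. degree G x)" using W by (intro sum_mono2) auto
  also have "\<dots> = 2 * card G" by (rule handshake[OF gG])
  also have "\<dots> \<le> 2 * (t * n)" using Gsize by simp
  finally have "(2 * t) * (20 * card ?H) \<le> (2 * t) * n" by (simp add: algebra_simps)
  then have "20 * card ?H \<le> n" using t1 by (simp only: mult_le_cancel1)
  moreover have "card W = card {x\<in>W. degree G x \<le> 40 * t} + card ?H"
    using fW by (subst card_Un_disjoint[symmetric]) (auto intro: arg_cong[of _ _ card])
  ultimately show ?thesis by simp
qed

text \<open>The vertex \<open>v\<close> goes to \<open>c\<close> and \<open>X\<close> is prescribed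
  by \<open>f\<close>; the other vertices follow in the stages \<open>A\<close>,
  \<open>U - A\<close> and \<open>M\<close>. The hypothesis \<open>allowed\<close> counts only
  leaves whose neighbours lie in \<open>X\<close> or equal \<open>v\<close>, so it stays valid
  however the stages in between turn out. As \<open>M\<close> contains \<open>L\<close>, it supplies
  the lower bound for the final bijection.\<close>

lemma spanning_embedding_completion:
  assumes tr: "tree V E" and gG: "graph {..<n} G" and v: "v \<in> V"
    and W: "W \<subseteq> {..<n}" "c \<notin> W" "card W + 1 = card V" "\<And>x. x \<in> W \<Longrightarrow> {c, x} \<notin> G"
    and Gsize: "card G \<le> t * n" and t1: "t \<ge> 1"
    and X: "X \<subseteq> V - {v}" "emb E G X f" "f ` X \<subseteq> {x\<in>W. degree G x \<le> 40 * t}" "card X \<le> 401 * t"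
    and L: "L \<subseteq> V - {v} - X" "\<And>w. w \<in> L \<Longrightarrow> leaf V E w"
    and allowed: "\<And>y. y \<in> W \<Longrightarrow>
      80 * t < card {w\<in>L. \<forall>u\<in>nbr E w - {v}. u \<in> X \<and> {f u, y} \<notin> G}"
    and K: "n \<le> K * K" "100 * ((401 * t + 2 * K + 1) * (40 * t + 1)) \<le> n"
    and cV: "card V \<le> n" "n \<le> card V + t"
  shows "\<exists>F. emb E G V F \<and> F v = c \<and> F ` (V - {v}) = W \<and> (\<forall>x\<in>X. F x = f x) \<and>
     (\<forall>u\<in>V - {v}. degree G (F u) \<le> 40 * t \<or> degree E u \<le> 2)"
proof -
  have gE: "graph V E" and fV: "finite V" using tr by (auto simp: tree_def graph_def)
  have fW: "finite W" using W(1) finite_subset by blast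
  have fX: "finite X" using X(1) fV by (meson finite_Diff finite_subset)
  define Z where "Z = (401 * t + 2 * K + 1) * (40 * t + 1)"
  have Zn: "100 * Z \<le> n" using K(2) by (simp add: Z_def)
  have Z1: "(401 * t + 2 * K) * (40 * t) + (401 * t + 2 * K) + 1 \<le> Z" by (simp add: Z_def algebra_simps)
  have Z2: "K * (40 * t) \<le> Z" "401 * t + 2 * K + 1 \<le> Z" by (simp_all add: Z_def algebra_simps)
  have n3: "card V \<ge> 3" using Zn Z2 t1 cV by linarith
  have loop: "{u} \<notin> E" for u using gE graph_no_loop by blast
  define low where "low = {x\<in>W. degree G x \<le> 40 * t}"
  have lowW: "low \<subseteq> W" by (auto simp: low_def)
  have flow: "finite low" using fW by (simp add: low_def)
  have clow: "card W = card low + card (W - low)"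
    using fW lowW by (simp add: card_Diff_subset card_mono flow)
  have high: "20 * card (W - low) \<le> n"
    using card_low_degree[OF gG W(1) Gsize t1] clow by (simp add: low_def)
  have degsum: "(\<Sum>u\<in>V. degree E u) + 2 \<le> 2 * card V" by (rule tree_degree_sum[OF tr])
  have degpos: "1 \<le> degree E u" if "u \<in> V" for u
    using tree_degree_pos[OF tr] n3 that by simp
  define B where "B = {u \<in> V - {v} - X. degree E u \<le> 2}"
  have fB: "finite B" using fV by (simp add: B_def)
  \<comment> \<open>All degrees are at least 1 and their sum is less than \<open>2 * card V\<close>,
    so at most half of the vertices have degree 3 or more.\<close>
  have Bsize: "card V \<le> 2 * card B + 2 + 2 * card X"
  proof -
    let ?H = "{u\<in>V. degree E u \<ge> 3}"
    have "card V + 2 * card ?H = (\<Sum>u\<in>V. 1 + (if degree E u \<ge> 3 then 2 else 0))"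
      unfolding sum.distrib using fV by (simp add: sum.If_cases Int_def)
    also have "\<dots> \<le> (\<Sum>u\<in>V. degree E u)"
      using degpos by (intro sum_mono) auto
    finally have H: "2 * card ?H \<le> card V" using degsum by linarith
    have "V \<subseteq> ?H \<union> B \<union> insert v X" by (auto simp: B_def)
    then have "card V \<le> card (?H \<union> B \<union> insert v X)"
      using fV fB fX by (intro card_mono) auto
    also have "\<dots> \<le> card ?H + card B + card (insert v X)"
      by (meson card_Un_le add_le_mono1 order_trans)
    also have "card (insert v X) \<le> 1 + card X" using fX by (simp add: card_insert_if)
    finally show ?thesis using H by linarith
  qed
  have "L \<subseteq> B" using L by (auto simp: B_def leaf_def)
  moreover have "{a, b} \<notin> E" if "a \<in> L" "b \<in> L" for a b
    using tree_leaves_nonadjacent[OF tr n3] L(2) that by simp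
  moreover have "degree E u \<le> 2" if "u \<in> B" for u using that by (simp add: B_def)
  ultimately obtain M where M: "L \<subseteq> M" "M \<subseteq> B" "\<forall>a\<in>M. \<forall>b\<in>M. {a, b} \<notin> E" "card B \<le> 3 * card M"
    using large_independent_superset[OF gE fB] by metis
  have fM: "finite M" using M fB finite_subset by blast
  \<comment> \<open>Holding back \<open>M\<close> frees more positions than are lost: at most
    \<open>n / 20\<close> have high \<open>G\<close>-degree and at most \<open>Z\<close> are
    excluded in a greedy step.\<close>
  have Msize: "n + 20 * Z \<le> 20 * card M"
    using Bsize M(4) X(4) cV Zn Z2 by linarith
  define U where "U = V - {v} - X - M"
  have fU: "finite U" using fV by (simp add: U_def)
  \<comment> \<open>Since \<open>n \<le> K * K\<close>, the degree sum allows at most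
    \<open>2 * K\<close> vertices of degree above \<open>K\<close>. Placed first, each of them sees
    at most \<open>card (X \<union> A)\<close> placed neighbours; all later vertices see at most
    \<open>K\<close>.\<close>
  define A where "A = {u\<in>U. degree E u > K}"
  have fA: "finite A" using fU by (simp add: A_def)
  have cA: "card A \<le> 2 * K"
  proof -
    have "card A * K = (\<Sum>u\<in>A. K)" by simp
    also have "\<dots> \<le> (\<Sum>u\<in>A. degree E u)" by (intro sum_mono) (auto simp: A_def)
    also have "\<dots> \<le> (\<Sum>u\<in>V. degree E u)" using fV by (intro sum_mono2) (auto simp: A_def U_def)
    also have "\<dots> \<le> 2 * (K * K)" using degsum cV K(1) by linarith
    finally have "card A * K \<le> (2 * K) * K" by simp
    moreover have "K > 0" using K(1) n3 cV by (cases K) auto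
    ultimately show ?thesis by simp
  qed
  have "\<exists>f'. emb E G (X \<union> A) f' \<and> (\<forall>x\<in>X. f' x = f x) \<and> f' ` (X \<union> A) \<subseteq> low"
  proof (rule greedy_extension[OF gG loop fA fX _ flow X(2), where d = "40 * t" and b = "401 * t + 2 * K"])
    show "X \<inter> A = {}" by (auto simp: A_def U_def)
    show "card (nbr E u \<inter> (X \<union> A)) \<le> 401 * t + 2 * K" for u
      using card_mono[of "X \<union> A" "nbr E u \<inter> (X \<union> A)"] card_Un_le[of X A] X(4) cA fX fA by fastforce
    show "card X + card A + (401 * t + 2 * K) * (40 * t) \<le> card low"
      using X(4) cA Z1 Zn clow high W(3) cV Z2 by linarith
  qed (use X(3) in \<open>auto simp: low_def\<close>)
  then obtain f1 where f1: "emb E G (X \<union> A) f1" "\<forall>x\<in>X. f1 x = f x" "f1 ` (X \<union> A) \<subseteq> low" by blast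
  have split: "X \<union> A \<union> (U - A) = V - {v} - M" "(X \<union> A) \<inter> (U - A) = {}"
    using X(1) M(2) by (auto simp: U_def A_def B_def)
  have Mv: "M \<subseteq> V - {v}" using M(2) by (auto simp: B_def)
  have cW: "card (V - {v}) = card W" using W(3) v fV by simp
  have cZ0: "card (V - {v} - M) = card W - card M" "card M \<le> card W"
    using Mv cW fM card_mono[of "V - {v}" M] fV by (simp_all add: card_Diff_subset)
  have "\<exists>f'. emb E G (X \<union> A \<union> (U - A)) f' \<and> (\<forall>x\<in>X \<union> A. f' x = f1 x) \<and> f' ` (X \<union> A \<union> (U - A)) \<subseteq> low"
  proof (rule greedy_extension[OF gG loop _ _ split(2) flow f1(1) f1(3), where d = "40 * t" and b = K])
    show "card (nbr E u \<inter> (X \<union> A \<union> (U - A))) \<le> K" if "u \<in> U - A" for u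
      using that card_mono[OF graph_finite_nbr[OF gE], of "nbr E u \<inter> (X \<union> A \<union> (U - A))" u]
      by (auto simp: A_def degree_nbr)
    have "card (X \<union> A) + card (U - A) = card (V - {v} - M)"
      using split fX fA fU by (subst card_Un_disjoint[symmetric]) auto
    then show "card (X \<union> A) + card (U - A) + K * (40 * t) \<le> card low"
      using cZ0 Msize high clow Z2(1) by linarith
  qed (use fX fA fU in \<open>auto simp: low_def\<close>)
  then obtain f2 where f2: "emb E G (V - {v} - M) f2" "\<forall>x\<in>X \<union> A. f2 x = f1 x" "f2 ` (V - {v} - M) \<subseteq> low"
    unfolding split by blast
  have f2X: "f2 x = f x" if "x \<in> X" for x using f2(2) f1(2) that by simp
  \<comment> \<open>\<open>R\<close> contains every position of high \<open>G\<close>-degree, since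
    all stages so far used only \<open>low\<close>. For such positions the condition on the
    bijection has to come from \<open>allowed\<close>.\<close>
  define R where "R = W - f2 ` (V - {v} - M)"
  have fR: "finite R" using fW by (simp add: R_def)
  have "card (f2 ` (V - {v} - M)) = card (V - {v} - M)"
    using f2(1) by (intro card_image) (simp add: emb_def)
  then have "card R = card W - card (V - {v} - M)"
    unfolding R_def using f2(3) lowW fV by (subst card_Diff_subset) auto
  then have cR: "card M = card R" using cZ0 by simp
  define good where "good w y \<longleftrightarrow> (\<forall>u\<in>nbr E w - {v}. {f2 u, y} \<notin> G)" for w y
  have nbM: "nbr E w - {v} \<subseteq> V - {v} - M" if "w \<in> M" for w
    using M(3) that graph_nbr_subset[OF gE, of w] by (auto simp: nbr_def)
  have "\<exists>g. bij_betw g M R \<and> (\<forall>w\<in>M. good w (g w))"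
  proof (rule bijection_avoiding_forbidden_pairs[OF fM fR cR])
    fix w assume w: "w \<in> M"
    let ?N = "nbr E w - {v}"
    have fN: "finite ?N" using graph_finite_nbr[OF gE] by simp
    have "card ?N \<le> 2"
      using w M(2) card_mono[OF graph_finite_nbr[OF gE], of ?N w] by (auto simp: B_def degree_nbr)
    have "card {y\<in>R. \<not> good w y} \<le> card (\<Union>u\<in>?N. nbr G (f2 u))"
    proof (rule card_mono)
      show "finite (\<Union>u\<in>?N. nbr G (f2 u))" using fN graph_finite_nbr[OF gG] by blast
      show "{y\<in>R. \<not> good w y} \<subseteq> (\<Union>u\<in>?N. nbr G (f2 u))"
        by (auto simp: good_def nbr_def insert_commute)
    qed
    also have "\<dots> \<le> (\<Sum>u\<in>?N. card (nbr G (f2 u)))" using fN by (rule card_UN_le)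
    also have "\<dots> \<le> (\<Sum>u\<in>?N. 40 * t)"
      using nbM[OF w] f2(3) by (intro sum_mono) (auto simp: low_def degree_nbr)
    also have "\<dots> \<le> 80 * t" using \<open>card ?N \<le> 2\<close> by simp
    finally show "card {y\<in>R. \<not> good w y} \<le> 80 * t" .
  next
    fix y assume y: "y \<in> R"
    then have "80 * t < card {w\<in>L. \<forall>u\<in>nbr E w - {v}. u \<in> X \<and> {f u, y} \<notin> G}"
      by (intro allowed) (simp add: R_def)
    also have "\<dots> \<le> card {w\<in>M. good w y}"
      using M(1) fM f2X by (intro card_mono) (auto simp: good_def)
    finally show "80 * t < card {w\<in>M. good w y}" .
  qed
  then obtain g where g: "bij_betw g M R" "\<forall>w\<in>M. good w (g w)" by blast
  define F where "F u = (if u = v then c else if u \<in> M then g u else f2 u)" for u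
  have FM: "F w = g w" if "w \<in> M" for w using that Mv by (auto simp: F_def)
  have FZ: "F w = f2 w" if "w \<in> V - {v} - M" for w using that by (auto simp: F_def)
  have Fv: "F v = c" by (simp add: F_def)
  have Vsplit: "V - {v} = M \<union> (V - {v} - M)" using Mv by auto
  have imM: "F ` M = R" using g(1) FM by (auto simp: bij_betw_def)
  have imZ: "F ` (V - {v} - M) = f2 ` (V - {v} - M)" using FZ by (intro image_cong) auto
  have img: "F ` (V - {v}) = W"
    using imM imZ f2(3) lowW by (subst Vsplit, subst image_Un) (auto simp: R_def)
  have "card (F ` V) = card V"
  proof -
    have "F ` V = insert c W" using img Fv v by auto
    then show ?thesis using W fW by simp
  qed
  then have inj: "inj_on F V" using fV by (simp add: eq_card_imp_inj_on)
  have MZ: "{F a, F b} \<notin> G" if ab: "a \<in> M" "b \<in> V - {v} - M" "{a, b} \<in> E" for a b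
  proof -
    have "b \<in> nbr E a - {v}" using ab by (auto simp: nbr_def insert_commute)
    then have "{f2 b, g a} \<notin> G" using g(2) ab unfolding good_def by blast
    then show ?thesis using FM FZ ab by (simp add: insert_commute)
  qed
  have vx: "{F v, F b} \<notin> G" if "b \<in> V - {v}" for b
    using W(4) img that Fv by auto
  have "{F a, F b} \<notin> G" if ab: "a \<in> V" "b \<in> V" "{a, b} \<in> E" for a b
  proof -
    have "a \<noteq> b" using ab(3) loop by auto
    consider "a = v" | "b = v" | "a \<in> M" "b \<in> M" | "a \<in> M" "b \<in> V - {v} - M"
      | "b \<in> M" "a \<in> V - {v} - M" | "a \<in> V - {v} - M" "b \<in> V - {v} - M"
      using ab by blast
    then show ?thesis
    proof cases
      case 1
      then show ?thesis using vx[of b] ab \<open>a \<noteq> b\<close> by auto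
    next
      case 2
      then show ?thesis using vx[of a] ab \<open>a \<noteq> b\<close> by (auto simp: insert_commute)
    next
      case 3
      then show ?thesis using M(3) ab by blast
    next
      case 4
      then show ?thesis using MZ ab by blast
    next
      case 5
      then show ?thesis using MZ[of b a] ab by (simp add: insert_commute)
    next
      case 6
      then show ?thesis using f2(1) ab FZ by (simp add: emb_def)
    qed
  qed
  then have "emb E G V F" using inj by (simp add: emb_def)
  moreover have "F x = f x" if "x \<in> X" for x
  proof -
    have "x \<in> V - {v} - M" using that X(1) M(2) unfolding B_def by blast
    then show ?thesis using FZ f2X that by simp
  qed
  moreover have "degree G (F u) \<le> 40 * t \<or> degree E u \<le> 2" if "u \<in> V - {v}" for u
  proof (cases "u \<in> M")
    case True
    then show ?thesis using M(2) by (auto simp: B_def)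
  next
    case False
    then have "F u \<in> low" using f2(3) FZ that by auto
    then show ?thesis by (simp add: low_def)
  qed
  ultimately show ?thesis using Fv img by (intro exI[of _ F]) simp
qed


section \<open>Anchors: tree vertices adjacent to leaves\<close>

definition leaf_nbrs :: "nat set \<Rightarrow> nat set set \<Rightarrow> nat \<Rightarrow> nat set" where
  "leaf_nbrs V E p = {w \<in> nbr E p. leaf V E w}"

lemma leaf_nbrs_nbr: "w \<in> leaf_nbrs V E p \<Longrightarrow> nbr E w = {p}"
  by (metis (mono_tags, lifting) leaf_nbr_singleton leaf_nbrs_def mem_Collect_eq nbr_sym singletonD)

text \<open>\<open>C\<close> consists of the hubs reserved for later trees, to be filled with the
  leaves \<open>\<Lambda>\<close>, and \<open>P\<close> is the set of anchors. Either
  \<open>v\<close> keeps more than \<open>80 * t\<close> leaves, which fit anywhere in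
  \<open>W\<close> because \<open>c\<close> has no \<open>G\<close>-edge to \<open>W\<close>; or the
  anchors are spread out so that each position is nonadjacent to at least \<open>h\<close> of them,
  each supplying \<open>g\<close> leaves.\<close>

lemma anchored_embedding:
  assumes tr: "tree V E" and gG: "graph {..<n} G" and v: "v \<in> V" "\<not> leaf V E v"
    and W: "W \<subseteq> {..<n}" "c \<notin> W" "card W + 1 = card V" "\<And>x. x \<in> W \<Longrightarrow> {c, x} \<notin> G"
    and Gsize: "card G \<le> t * n" and t1: "t \<ge> 1"
    and degW: "\<And>y. y \<in> W \<Longrightarrow> 2 * degree G y \<le> n + 250 * t"
    and C: "C \<subseteq> W" "card C \<le> t" "\<And>x. x \<in> C \<Longrightarrow> degree G x \<le> t"
    and \<Lambda>: "\<Lambda> \<subseteq> {w. leaf V E w}" "card \<Lambda> = card C"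
    and P: "P \<subseteq> V - {v}" "\<And>p. p \<in> P \<Longrightarrow> \<not> leaf V E p" "card P \<le> 400 * t"
    and anchors: "81 * t \<le> card (leaf_nbrs V E v - \<Lambda>) \<or>
      (\<exists>g h. (\<forall>p\<in>P. g \<le> card (leaf_nbrs V E p - \<Lambda>)) \<and> 80 * t < h * g \<and>
         real n * 2 ^ h * (5/6) ^ card P < 1)"
    and K: "n \<le> K * K" "100 * ((401 * t + 2 * K + 1) * (40 * t + 1)) \<le> n"
    and cV: "card V \<le> n" "n \<le> card V + t"
  shows "\<exists>F. emb E G V F \<and> F v = c \<and> F ` (V - {v}) = W \<and> F ` \<Lambda> = C \<and>
     (\<forall>u\<in>V - {v}. degree G (F u) \<le> 40 * t \<or> degree E u \<le> 2)"
proof -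
  have gE: "graph V E" and fV: "finite V" using tr by (auto simp: tree_def graph_def)
  have fW: "finite W" using W(1) finite_subset by blast
  have \<Lambda>V: "\<Lambda> \<subseteq> V" using \<Lambda>(1) by (auto simp: leaf_def)
  have f\<Lambda>: "finite \<Lambda>" using \<Lambda>V fV finite_subset by blast
  have fC: "finite C" using C(1) fW finite_subset by blast
  have fP: "finite P" using P(1) fV finite_subset by blast
  define Z where "Z = (401 * t + 2 * K + 1) * (40 * t + 1)"
  have Zn: "100 * Z \<le> n" using K(2) by (simp add: Z_def)
  have Z1: "(401 * t) * (40 * t + 1) \<le> Z" "401 * t + 1 \<le> Z" by (simp_all add: Z_def algebra_simps)
  have n3: "card V \<ge> 3" using Zn Z1 t1 cV by linarith
  have loop: "{u} \<notin> E" for u using gE graph_no_loop by blast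
  define low where "low = {x\<in>W. degree G x \<le> 40 * t}"
  have flow: "finite low" using fW by (simp add: low_def)
  have clow: "20 * card W \<le> 20 * card low + n"
    using card_low_degree[OF gG W(1) Gsize t1] by (simp add: low_def)
  obtain f0 where f0: "bij_betw f0 \<Lambda> C" using finite_same_card_bij[OF f\<Lambda> fC \<Lambda>(2)] by blast
  \<comment> \<open>Leaves are pairwise nonadjacent, so any bijection from \<open>\<Lambda>\<close>
    to \<open>C\<close> is an embedding.\<close>
  have e0: "emb E G \<Lambda> f0"
    using f0 \<Lambda>(1) tree_leaves_nonadjacent[OF tr n3] by (auto simp: emb_def bij_betw_def)
  have im0: "f0 ` \<Lambda> \<subseteq> low" using f0 C(1,3) by (fastforce simp: bij_betw_def low_def)
  have disj: "\<Lambda> \<inter> P = {}" using \<Lambda>(1) P(2) by auto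
  have cXP: "card \<Lambda> + card P \<le> 401 * t" using \<Lambda>(2) C(2) P(3) by simp
  have small: "(card \<Lambda> + card P) * (40 * t + 1) \<le> Z"
    using mult_le_mono1[OF cXP, of "40 * t + 1"] Z1(1) by linarith
  have "\<exists>f'. emb E G (\<Lambda> \<union> P) f' \<and> (\<forall>x\<in>\<Lambda>. f' x = f0 x) \<and> f' ` (\<Lambda> \<union> P) \<subseteq> low \<and>
     (\<Sum>y\<in>W. (1/2) ^ card {p\<in>P. {f' p, y} \<notin> G}) \<le> (5/6) ^ card P * real (card W)"
  proof (rule diversified_extension[OF gG loop fP f\<Lambda> disj flow fW e0 im0, where d = "40 * t"])
    fix y assume "y \<in> W"
    then show "3 * degree G y + 2 * (card \<Lambda> + card P) * (40 * t + 1) \<le> 2 * card low"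
      using degW[of y] small Zn Z1(2) clow W(3) cV unfolding mult.assoc by linarith
  next
    show "(card \<Lambda> + card P) * (40 * t + 1) < card low"
      using small Zn Z1(2) clow W(3) cV by linarith
  qed (simp add: low_def)
  then obtain f where f: "emb E G (\<Lambda> \<union> P) f" "\<forall>x\<in>\<Lambda>. f x = f0 x" "f ` (\<Lambda> \<union> P) \<subseteq> low"
    and wt: "(\<Sum>y\<in>W. (1/2) ^ card {p\<in>P. {f p, y} \<notin> G}) \<le> (5/6) ^ card P * real (card W)"
    by blast
  define L where "L = {w. leaf V E w} - \<Lambda>"
  have fL: "finite L" using fV by (rule rev_finite_subset) (auto simp: L_def leaf_def)
  have allowed: "80 * t < card {w\<in>L. \<forall>u\<in>nbr E w - {v}. u \<in> \<Lambda> \<union> P \<and> {f u, y} \<notin> G}"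
    (is "_ < card ?A") if y: "y \<in> W" for y
    using anchors
  proof
    assume a: "81 * t \<le> card (leaf_nbrs V E v - \<Lambda>)"
    \<comment> \<open>The only neighbour of such a leaf is \<open>v\<close>, so the condition
      defining \<open>?A\<close> is vacuous.\<close>
    have "leaf_nbrs V E v - \<Lambda> \<subseteq> ?A"
      using leaf_nbrs_nbr[of _ V E v] by (auto simp: L_def leaf_nbrs_def)
    then have "card (leaf_nbrs V E v - \<Lambda>) \<le> card ?A" using fL by (intro card_mono) auto
    then show ?thesis using a t1 by linarith
  next
    assume "\<exists>g h. (\<forall>p\<in>P. g \<le> card (leaf_nbrs V E p - \<Lambda>)) \<and> 80 * t < h * g \<and>
         real n * 2 ^ h * (5/6) ^ card P < 1"
    then obtain g h where g: "\<And>p. p \<in> P \<Longrightarrow> g \<le> card (leaf_nbrs V E p - \<Lambda>)" "80 * t < h * g"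
      and small: "real n * 2 ^ h * (5/6) ^ card P < 1" by blast
    define H where "H = {p\<in>P. {f p, y} \<notin> G}"
    have fH: "finite H" using fP by (simp add: H_def)
    \<comment> \<open>The weight of the single position \<open>y\<close> is at most the total
      weight, which is below \<open>(1/2) ^ h\<close>; hence \<open>y\<close> has been missed by at
      least \<open>h\<close> anchors.\<close>
    have "(1/2) ^ card H \<le> (\<Sum>y\<in>W. (1/2::real) ^ card {p\<in>P. {f p, y} \<notin> G})"
      unfolding H_def using y fW by (intro member_le_sum) auto
    also have "\<dots> \<le> (5/6) ^ card P * real n"
      using wt W(3) cV(1) by (elim order_trans) (intro mult_left_mono, auto)
    also have "\<dots> < (1/2) ^ h"
      using small by (simp add: power_divide field_simps)
    finally have hH: "h \<le> card H"
      by (meson linorder_not_le order_less_imp_le power_decreasing zero_le_divide_1_iff zero_le_numeral divide_le_eq_1 one_le_numeral zero_less_numeral)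
    have "80 * t < h * g" by (rule g)
    also have "\<dots> \<le> card H * g" using hH by simp
    also have "\<dots> = (\<Sum>p\<in>H. g)" by simp
    also have "\<dots> \<le> (\<Sum>p\<in>H. card (leaf_nbrs V E p - \<Lambda>))"
      using g(1) by (intro sum_mono) (simp add: H_def)
    \<comment> \<open>A leaf has only one neighbour, so different anchors have disjoint sets of
      leaves.\<close>
    also have "\<dots> = card (\<Union>p\<in>H. leaf_nbrs V E p - \<Lambda>)"
    proof (rule card_UN_disjoint[symmetric, OF fH])
      show "\<forall>i\<in>H. finite (leaf_nbrs V E i - \<Lambda>)"
        using graph_finite_nbr[OF gE] by (simp add: leaf_nbrs_def)
      show "\<forall>i\<in>H. \<forall>j\<in>H. i \<noteq> j \<longrightarrow> (leaf_nbrs V E i - \<Lambda>) \<inter> (leaf_nbrs V E j - \<Lambda>) = {}"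
        using leaf_nbrs_nbr by blast
    qed
    also have "\<dots> \<le> card ?A"
    proof (rule card_mono)
      show "(\<Union>p\<in>H. leaf_nbrs V E p - \<Lambda>) \<subseteq> ?A"
      proof
        fix w assume "w \<in> (\<Union>p\<in>H. leaf_nbrs V E p - \<Lambda>)"
        then obtain p where p: "p \<in> H" "w \<in> leaf_nbrs V E p" "w \<notin> \<Lambda>" by blast
        then show "w \<in> ?A"
          using leaf_nbrs_nbr[OF p(2)] by (auto simp: L_def leaf_nbrs_def H_def)
      qed
    qed (use fL in simp)
    finally show ?thesis .
  qed
  have v\<Lambda>: "v \<notin> \<Lambda>" using v(2) \<Lambda>(1) by auto
  have XV: "\<Lambda> \<union> P \<subseteq> V - {v}" using \<Lambda>V v\<Lambda> P(1) by blast
  have LV: "L \<subseteq> V - {v} - (\<Lambda> \<union> P)" using v(2) P(2) by (auto simp: L_def leaf_def)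
  have cX: "card (\<Lambda> \<union> P) \<le> 401 * t" using cXP card_Un_le[of \<Lambda> P] by linarith
  obtain F where F: "emb E G V F" "F v = c" "F ` (V - {v}) = W" "\<forall>x\<in>\<Lambda> \<union> P. F x = f x"
     "\<forall>u\<in>V - {v}. degree G (F u) \<le> 40 * t \<or> degree E u \<le> 2"
    using spanning_embedding_completion[OF tr gG v(1) W Gsize t1 XV f(1) _ cX LV _ allowed K cV]
      f(3) by (auto simp: low_def L_def)
  moreover have "F ` \<Lambda> = C" using F(4) f(2) f0 by (auto simp: bij_betw_def)
  ultimately show ?thesis by blast
qed

section \<open>Choosing the hub\<close>

text \<open>The other \<open>card V - 2\<close> vertices each take at least 1 from a degree sum of
  at most \<open>2 * card V - 2\<close>. Consequently at most one vertex can have degree above half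
  of \<open>card V\<close>.\<close>

lemma tree_two_degrees:
  assumes tr: "tree V E" and c: "card V \<ge> 2" and uv: "u \<in> V" "v \<in> V" "u \<noteq> v"
  shows "degree E u + degree E v \<le> card V"
proof -
  have fV: "finite V" using tr by (auto simp: tree_def graph_def)
  have "card V - 2 = (\<Sum>x\<in>V - {u, v}. 1)" using uv fV by (simp add: card_Diff_subset)
  also have "\<dots> \<le> (\<Sum>x\<in>V - {u, v}. degree E x)"
    using tree_degree_pos[OF tr c] by (intro sum_mono) auto
  finally have "card V - 2 \<le> (\<Sum>x\<in>V - {u, v}. degree E x)" .
  moreover have "(\<Sum>x\<in>V. degree E x) = (\<Sum>x\<in>V - {u, v}. degree E x) + (\<Sum>x\<in>{u, v}. degree E x)"
    using uv fV by (intro sum.subset_diff) auto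
  moreover have "(\<Sum>x\<in>{u, v}. degree E x) = degree E u + degree E v" using uv(3) by simp
  ultimately show ?thesis using tree_degree_sum[OF tr] c by linarith
qed

text \<open>A neighbour of \<open>v\<close> that is not a leaf contributes at least 2 to the degree
  sum and any other vertex at least 1. So a degree well above \<open>card V / 2\<close> can only be
  due to leaves.\<close>

lemma tree_degree_le_leaf_nbrs:
  assumes tr: "tree V E" and c: "card V \<ge> 2" and v: "v \<in> V"
  shows "2 * degree E v \<le> card V + card (leaf_nbrs V E v)"
proof -
  have gE: "graph V E" and fV: "finite V" using tr by (auto simp: tree_def graph_def)
  define Q where "Q = nbr E v - leaf_nbrs V E v"
  have NV: "nbr E v \<subseteq> V - {v}"
    using graph_nbr_subset[OF gE, of v] graph_no_loop[OF gE, of v] by (auto simp: nbr_def)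
  have fQ: "finite Q" using graph_finite_nbr[OF gE] by (simp add: Q_def)
  have sub: "leaf_nbrs V E v \<subseteq> nbr E v" by (auto simp: leaf_nbrs_def)
  have fN: "finite (nbr E v)" by (rule graph_finite_nbr[OF gE])
  have cQ: "degree E v = card Q + card (leaf_nbrs V E v)"
    using card_Diff_subset[OF finite_subset[OF sub fN] sub] card_mono[OF fN sub]
    by (simp add: Q_def degree_nbr)
  have QV: "Q \<subseteq> V - {v}" using NV by (auto simp: Q_def)
  have "card V - 1 + card Q = (\<Sum>x\<in>V - {v}. 1 + (if x \<in> Q then 1 else 0))"
    unfolding sum.distrib using fV v Int_absorb1[OF QV] by (simp add: sum.If_cases)
  also have "\<dots> \<le> (\<Sum>x\<in>V - {v}. degree E x)"
  proof (rule sum_mono)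
    fix x assume x: "x \<in> V - {v}"
    have "degree E x \<noteq> 1" if "x \<in> Q" using that x by (auto simp: Q_def leaf_nbrs_def leaf_def)
    then show "1 + (if x \<in> Q then 1 else 0) \<le> degree E x"
      using tree_degree_pos[OF tr c, of x] x by auto
  qed
  finally have "card V - 1 + card Q + degree E v \<le> (\<Sum>x\<in>V. degree E x)"
    using v fV by (simp add: sum.remove)
  then show ?thesis using tree_degree_sum[OF tr] cQ c by linarith
qed

text \<open>Vertices of \<open>S\<close> with fewer than \<open>2 * t\<close> leaf neighbours
  account for at most \<open>m * (2 * t)\<close>, hence at most \<open>m\<^sup>2 / 2\<close>, of the
  leaves. The others have at most \<open>82 * t\<close>, hence at most \<open>41 * m / 2\<close>,
  each, so there are at least \<open>m / 41\<close> of them.\<close>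

lemma many_anchors_cond1:
  assumes tr: "tree V E" and S: "S \<subseteq> V" "real (card S) \<le> m" "m\<^sup>2 \<le> real (card {w \<in> nbhd_union E S. leaf V E w})"
    and t: "t \<ge> 1" "4 * real t \<le> m"
    and few: "\<And>v. v \<in> V \<Longrightarrow> card (leaf_nbrs V E v) \<le> 82 * t"
  shows "m / 41 \<le> real (card {s\<in>S. 2 * t \<le> card (leaf_nbrs V E s)})"
proof -
  have gE: "graph V E" and fV: "finite V" using tr by (auto simp: tree_def graph_def)
  have fS: "finite S" using S(1) fV finite_subset by blast
  let ?T = "{s\<in>S. 2 * t \<le> card (leaf_nbrs V E s)}"
  have "{w \<in> nbhd_union E S. leaf V E w} \<subseteq> (\<Union>s\<in>S. leaf_nbrs V E s)"
    by (auto simp: nbhd_union_def leaf_nbrs_def nbr_def insert_commute)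
  moreover have "finite (\<Union>s\<in>S. leaf_nbrs V E s)"
    using fS graph_finite_nbr[OF gE] by (auto simp: leaf_nbrs_def)
  ultimately have "card {w \<in> nbhd_union E S. leaf V E w} \<le> card (\<Union>s\<in>S. leaf_nbrs V E s)"
    by (intro card_mono)
  also have "\<dots> \<le> (\<Sum>s\<in>S. card (leaf_nbrs V E s))" using fS by (rule card_UN_le)
  also have "\<dots> \<le> (\<Sum>s\<in>S. 2 * t + (if 2 * t \<le> card (leaf_nbrs V E s) then 82 * t else 0))"
  proof (rule sum_mono)
    fix s assume "s \<in> S"
    then have "card (leaf_nbrs V E s) \<le> 82 * t" using few S(1) by blast
    then show "card (leaf_nbrs V E s) \<le> 2 * t + (if 2 * t \<le> card (leaf_nbrs V E s) then 82 * t else 0)"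
      by simp
  qed
  also have "\<dots> = card S * (2 * t) + card ?T * (82 * t)"
    unfolding sum.distrib using fS by (simp add: sum.If_cases Int_def)
  finally have "m\<^sup>2 \<le> real (card S * (2 * t) + card ?T * (82 * t))"
    using S(3) by (meson of_nat_le_iff order_trans)
  also have "\<dots> = real (card S) * (2 * real t) + real (card ?T) * (82 * real t)" by simp
  also have "\<dots> \<le> m * (m / 2) + real (card ?T) * (41 / 2 * m)"
  proof (rule add_mono)
    show "real (card S) * (2 * real t) \<le> m * (m / 2)" using S(2) t by (intro mult_mono) auto
    show "real (card ?T) * (82 * real t) \<le> real (card ?T) * (41 / 2 * m)"
      using t by (intro mult_left_mono) auto
  qed
  finally have "m * (m / 2) \<le> m * (41 / 2 * real (card ?T))" by (simp add: power2_eq_square algebra_simps)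
  moreover have "m > 0" using t by linarith
  ultimately show ?thesis by (simp add: mult_le_cancel_left_pos)
qed

text \<open>Here \<open>s\<close> counts the hubs still reserved. If a vertex with
  \<open>82 * t\<close> leaf neighbours exists and all other degrees are about \<open>n / 2\<close>
  at most, it becomes \<open>v\<close>, with \<open>\<Lambda>\<close> taken among its leaves and no
  anchors. Otherwise all degrees are about \<open>n / 2\<close> at most and no vertex has that many
  leaves, so \<open>cond1\<close> or \<open>cond2\<close> provides many anchors, one of which
  becomes \<open>v\<close>.\<close>

lemma hub_selection:
  assumes tr: "tree V E" and cV: "3 \<le> card V" "card V \<le> n" and st: "s \<le> t" and t: "t \<ge> 1"
    and m: "m = real n powr (1/3)" "4 * real t \<le> m" "m \<le> 400 * real t" "401 * real t + 1 \<le> m\<^sup>2"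
    and few_anchors: "\<forall>k. m / 41 \<le> real k + 1 \<longrightarrow> real n * 2 ^ 81 * (5/6) ^ k < 1"
    and many_anchors: "real n * 2 ^ (80 * t + 1) * (5/6) ^ (400 * t) < 1"
    and conds: "cond1 n V E \<or> cond2 n V E"
  shows "\<exists>v \<Lambda> P. v \<in> V \<and> \<not> leaf V E v \<and> \<Lambda> \<subseteq> {w. leaf V E w} \<and> card \<Lambda> = s \<and>
     P \<subseteq> V - {v} \<and> (\<forall>p\<in>P. \<not> leaf V E p) \<and> card P \<le> 400 * t \<and>
     (81 * t \<le> card (leaf_nbrs V E v - \<Lambda>) \<or>
      (\<exists>g h. (\<forall>p\<in>P. g \<le> card (leaf_nbrs V E p - \<Lambda>)) \<and> 80 * t < h * g \<and>
         real n * 2 ^ h * (5/6) ^ card P < 1)) \<and>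
     (\<forall>u\<in>V - {v}. 2 * degree E u \<le> n + 82 * t) \<and>
     (2 * degree E v \<le> n + 82 * t \<or> \<Lambda> \<subseteq> nbr E v)"
proof -
  have gE: "graph V E" and fV: "finite V" and neV: "V \<noteq> {}" using tr by (auto simp: tree_def graph_def)
  have flv: "finite (leaf_nbrs V E p)" for p using graph_finite_nbr[OF gE] by (simp add: leaf_nbrs_def)
  have c2: "card V \<ge> 2" using cV by simp
  have lvdeg: "card (leaf_nbrs V E p) \<le> degree E p" for p
    unfolding degree_nbr using graph_finite_nbr[OF gE, of p] by (intro card_mono) (auto simp: leaf_nbrs_def)
  have m2: "real n powr (2/3) = m\<^sup>2"
    using m(1) by (simp add: power2_eq_square powr_add[symmetric])
  have remove: "card (leaf_nbrs V E p) \<le> card (leaf_nbrs V E p - \<Lambda>) + t" if "finite \<Lambda>" "card \<Lambda> = s" for p \<Lambda>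
    using diff_card_le_card_Diff[OF that(1), of "leaf_nbrs V E p"] that st by linarith
  show ?thesis
  proof (cases "\<exists>v\<in>V. 82 * t \<le> card (leaf_nbrs V E v) \<and> (\<forall>u\<in>V - {v}. 2 * degree E u \<le> n + 82 * t)")
    case True
    then obtain v where v: "v \<in> V" "82 * t \<le> card (leaf_nbrs V E v)"
      and d: "\<forall>u\<in>V - {v}. 2 * degree E u \<le> n + 82 * t" by blast
    obtain \<Lambda> where \<Lambda>: "\<Lambda> \<subseteq> leaf_nbrs V E v" "card \<Lambda> = s" "finite \<Lambda>"
      using obtain_subset_with_card_n[of s "leaf_nbrs V E v"] v(2) st by auto
    have "81 * t \<le> card (leaf_nbrs V E v - \<Lambda>)" using remove[OF \<Lambda>(3,2), of v] v(2) by linarith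
    moreover have "\<not> leaf V E v" using v(2) lvdeg[of v] t by (auto simp: leaf_def)
    moreover have "\<Lambda> \<subseteq> nbr E v" "\<Lambda> \<subseteq> {w. leaf V E w}" using \<Lambda>(1) by (auto simp: leaf_nbrs_def)
    ultimately show ?thesis using v d \<Lambda>(2) 
      by - (rule exI[of _ v], rule exI[of _ \<Lambda>], rule exI[of _ "{}"], simp)
  next
    case False
    obtain x where x: "x \<in> V" and xmax: "\<And>u. u \<in> V \<Longrightarrow> degree E u \<le> degree E x"
    proof -
      have "Max (degree E ` V) \<in> degree E ` V" using fV neV by (intro Max_in) auto
      then obtain x where "x \<in> V" "degree E x = Max (degree E ` V)" by auto
      then show thesis using that[of x] fV by simp
    qed
    \<comment> \<open>All vertices other than \<open>x\<close> have degree at most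
      \<open>card V / 2\<close>, so with \<open>82 * t\<close> leaf neighbours \<open>x\<close>
      would fall under the first case.\<close>
    have "card (leaf_nbrs V E x) < 82 * t"
    proof (rule ccontr)
      assume "\<not> ?thesis"
      moreover have "2 * degree E u \<le> n + 82 * t" if "u \<in> V - {x}" for u
        using tree_two_degrees[OF tr c2, of u x] xmax[of u] that x cV by auto
      ultimately show False using False x by force
    qed
    then have "2 * degree E x \<le> n + 82 * t" using tree_degree_le_leaf_nbrs[OF tr c2 x] cV by linarith
    then have d: "2 * degree E u \<le> n + 82 * t" if "u \<in> V" for u using xmax[OF that] by linarith
    then have few: "card (leaf_nbrs V E v) \<le> 82 * t" if "v \<in> V" for v
      using False that by (meson DiffD1 nat_le_linear)
    \<comment> \<open>\<open>Q\<close> has one element more than the final anchor set, because one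
      of its vertices is taken out as the hub \<open>v\<close>; hence the exponent
      \<open>card Q - 1\<close>.\<close>
    have "\<exists>\<Lambda> Q g h. \<Lambda> \<subseteq> {w. leaf V E w} \<and> card \<Lambda> = s \<and> Q \<subseteq> V \<and> Q \<noteq> {} \<and> (\<forall>p\<in>Q. \<not> leaf V E p) \<and>
      card Q \<le> 400 * t + 1 \<and> (\<forall>p\<in>Q. g \<le> card (leaf_nbrs V E p - \<Lambda>)) \<and> 80 * t < h * g \<and>
      real n * 2 ^ h * (5/6) ^ (card Q - 1) < 1"
      using conds
    proof
      assume "cond1 n V E"
      then obtain S where S: "S \<subseteq> V" "real (card S) \<le> m"
          "m\<^sup>2 \<le> real (card {w \<in> nbhd_union E S. leaf V E w})"
        using m2 m(1) by (auto simp: cond1_def)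
      \<comment> \<open>Vertices of \<open>?Q\<close> keep at least \<open>t\<close> of their
        \<open>2 * t\<close> leaves after the removal of \<open>\<Lambda>\<close>. So
        \<open>g = t\<close>, and \<open>h = 81\<close> gives more than \<open>80 * t\<close>
        leaves.\<close>
      let ?L = "{w \<in> nbhd_union E S. leaf V E w}" and ?Q = "{s\<in>S. 2 * t \<le> card (leaf_nbrs V E s)}"
      have "real t \<le> real (card ?L)" using S(3) m(4) by linarith
      then have "s \<le> card ?L" using st by linarith
      then obtain \<Lambda> where \<Lambda>: "\<Lambda> \<subseteq> ?L" "card \<Lambda> = s" "finite \<Lambda>"
        using obtain_subset_with_card_n by metis
      have fS: "finite S" using S(1) fV finite_subset by blast
      have Q: "m / 41 \<le> real (card ?Q)"
        by (rule many_anchors_cond1[OF tr S t m(2) few])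
      have "card ?Q \<le> card S" using fS by (intro card_mono) auto
      then have "card ?Q \<le> 400 * t + 1" using S(2) m(3) by linarith
      moreover have "card ?Q > 0" using Q m(2) t by (cases "card ?Q") auto
      moreover from this have "real n * 2 ^ 81 * (5/6) ^ (card ?Q - 1) < 1"
        using Q by (intro few_anchors[rule_format]) simp
      moreover have "t \<le> card (leaf_nbrs V E p - \<Lambda>)" if "p \<in> ?Q" for p
        using remove[OF \<Lambda>(3,2), of p] that by simp
      moreover have "\<not> leaf V E p" if "p \<in> ?Q" for p
        using that lvdeg[of p] t by (auto simp: leaf_def)
      ultimately show ?thesis
        using \<Lambda> S(1) t
        by - (rule exI[of _ \<Lambda>], rule exI[of _ ?Q], rule exI[of _ t], rule exI[of _ 81],
          intro conjI ballI, simp_all add: card_gt_0_iff subset_iff del: power_numeral)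
    next
      assume "cond2 n V E"
      then obtain L where L: "independent_leaves V E L" "m\<^sup>2 \<le> real (card L)"
        using m2 by (auto simp: cond2_def)
      have fL: "finite L" using L(1) fV by (auto simp: independent_leaves_def leaf_def intro: rev_finite_subset)
      have cL: "401 * t + 1 \<le> card L" using L(2) m(4) by linarith
      then obtain \<Lambda> where \<Lambda>: "\<Lambda> \<subseteq> L" "card \<Lambda> = s" "finite \<Lambda>"
        using obtain_subset_with_card_n[of s L] st by auto
      \<comment> \<open>The neighbour of an independent leaf is only guaranteed that one leaf, so
        \<open>g = 1\<close> and \<open>h = 80 * t + 1\<close>. The \<open>400 * t + 1\<close>
        leaves yield \<open>400 * t\<close> anchors and the hub.\<close>
      have "400 * t + 1 \<le> card (L - \<Lambda>)"
        using diff_card_le_card_Diff[OF \<Lambda>(3), of L] \<Lambda>(2) st cL by linarith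
      then obtain L1 where L1: "L1 \<subseteq> L - \<Lambda>" "card L1 = 400 * t + 1"
        using obtain_subset_with_card_n by metis
      define par where "par w = (SOME p. p \<in> nbr E w)" for w
      have par: "par w \<in> nbr E w" if "w \<in> L" for w
      proof -
        have "\<exists>p. p \<in> nbr E w" using that L(1) leaf_nbr_singleton[of V E w]
          by (metis independent_leaves_def insertI1)
        then show ?thesis unfolding par_def by (rule someI_ex)
      qed
      have inj: "inj_on par L"
      proof (rule inj_onI, rule ccontr)
        fix a b assume ab: "a \<in> L" "b \<in> L" "par a = par b" "a \<noteq> b"
        have "{a, par a} \<in> E" "{b, par b} \<in> E"
          using par[of a] par[of b] ab(1,2) by (simp_all add: nbr_def insert_commute)
        then have "{a, par a} \<inter> {b, par b} = {}" using ab L(1) unfolding independent_leaves_def by blast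
        then show False using ab by auto
      qed
      let ?Q = "par ` L1"
      have L1L: "L1 \<subseteq> L" "L1 \<inter> \<Lambda> = {}" using L1 by auto
      have cQ: "card ?Q = 400 * t + 1" using inj L1L L1(2) by (simp add: card_image inj_on_subset)
      have leafL: "leaf V E w" if "w \<in> L" for w using that L(1) by (simp add: independent_leaves_def)
      have "\<not> leaf V E (par w)" if "w \<in> L1" for w
        using tree_leaves_nonadjacent[OF tr cV(1), of "par w" w] par[of w] leafL that L1L
        by (auto simp: nbr_def)
      moreover have "1 \<le> card (leaf_nbrs V E (par w) - \<Lambda>)" if "w \<in> L1" for w
      proof -
        have "w \<in> leaf_nbrs V E (par w) - \<Lambda>"
          using that L1L par[of w] leafL nbr_sym[of w E "par w"] by (auto simp: leaf_nbrs_def)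
        then show ?thesis using flv[of "par w"] by (simp add: Suc_le_eq card_gt_0_iff) blast
      qed
      moreover have "par w \<in> V" if "w \<in> L1" for w
        using par[of w] that L1L graph_nbr_subset[OF gE, of w] by auto
      moreover have "L1 \<noteq> {}" using L1(2) by auto
      ultimately have Q: "?Q \<subseteq> V" "?Q \<noteq> {}" "\<forall>p\<in>?Q. \<not> leaf V E p"
        "\<forall>p\<in>?Q. 1 \<le> card (leaf_nbrs V E p - \<Lambda>)" by blast+
      moreover have "real n * 2 ^ (80 * t + 1) * (5/6) ^ (card ?Q - 1) < 1"
        using many_anchors unfolding cQ by simp
      moreover have "80 * t < (80 * t + 1) * 1" "card ?Q \<le> 400 * t + 1" "\<Lambda> \<subseteq> {w. leaf V E w}"
        using cQ \<Lambda>(1) leafL by auto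
      ultimately show ?thesis using \<Lambda>(2)
        by - (rule exI[of _ \<Lambda>], rule exI[of _ ?Q], rule exI[of _ 1], rule exI[of _ "80 * t + 1"],
          intro conjI)
    qed
    then obtain \<Lambda> Q g h where \<Lambda>: "\<Lambda> \<subseteq> {w. leaf V E w}" "card \<Lambda> = s"
      and Q: "Q \<subseteq> V" "Q \<noteq> {}" "\<forall>p\<in>Q. \<not> leaf V E p" "card Q \<le> 400 * t + 1"
        "\<forall>p\<in>Q. g \<le> card (leaf_nbrs V E p - \<Lambda>)" "80 * t < h * g"
        "real n * 2 ^ h * (5/6) ^ (card Q - 1) < 1"
      by blast
    obtain v where v: "v \<in> Q" using Q(2) by blast
    have cP: "card (Q - {v}) = card Q - 1" using v by simp
    show ?thesis
    proof (rule exI[of _ v], rule exI[of _ \<Lambda>], rule exI[of _ "Q - {v}"], intro conjI)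
      have "\<exists>g h. (\<forall>p\<in>Q - {v}. g \<le> card (leaf_nbrs V E p - \<Lambda>)) \<and> 80 * t < h * g \<and>
         real n * 2 ^ h * (5/6) ^ card (Q - {v}) < 1"
        unfolding cP using Q(5-7) by blast
      then show "81 * t \<le> card (leaf_nbrs V E v - \<Lambda>) \<or>
        (\<exists>g h. (\<forall>p\<in>Q - {v}. g \<le> card (leaf_nbrs V E p - \<Lambda>)) \<and> 80 * t < h * g \<and>
         real n * 2 ^ h * (5/6) ^ card (Q - {v}) < 1)" by (rule disjI2)
      show "card (Q - {v}) \<le> 400 * t" using cP Q(4) by simp
      show "2 * degree E v \<le> n + 82 * t \<or> \<Lambda> \<subseteq> nbr E v" using d v Q(1) by blast
    qed (use v Q(1,3) \<Lambda> d in blast)+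
  qed
qed

section \<open>Packing the trees\<close>

lemma image_edge_iff:
  assumes gE: "graph V E" and inj: "inj_on F V" and ab: "a \<in> V" "b \<in> V"
  shows "{F a, F b} \<in> image F ` E \<longleftrightarrow> {a, b} \<in> E"
proof
  assume "{F a, F b} \<in> image F ` E"
  then obtain e where e: "e \<in> E" "{F a, F b} = F ` e" by auto
  have "e \<subseteq> V" using e(1) gE by (auto simp: graph_def)
  moreover have "F ` {a, b} = F ` e" using e(2) by simp
  ultimately have "{a, b} = e" using inj_on_image_eq_iff[OF inj, of "{a, b}" e] ab by simp
  then show "{a, b} \<in> E" using e(1) by simp
next
  assume "{a, b} \<in> E"
  then have "F ` {a, b} \<in> image F ` E" by (rule imageI)
  then show "{F a, F b} \<in> image F ` E" by simp
qed

lemma nbr_image: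
  assumes gE: "graph V E" and inj: "inj_on F V" and u: "u \<in> V"
  shows "nbr (image F ` E) (F u) = F ` nbr E u"
proof (intro equalityI subsetI)
  fix y assume "y \<in> nbr (image F ` E) (F u)"
  then have y: "{y, F u} \<in> image F ` E" by (simp add: nbr_def)
  then obtain e where e: "e \<in> E" "{y, F u} = F ` e" by auto
  have "e \<subseteq> V" using e(1) gE by (auto simp: graph_def)
  moreover have "y \<in> F ` e" using e(2)[symmetric] by simp
  ultimately have "y \<in> F ` V" by blast
  then obtain b where b: "b \<in> V" "y = F b" by auto
  then have "{b, u} \<in> E" using y image_edge_iff[OF gE inj b(1) u] by simp
  then show "y \<in> F ` nbr E u" using b by (auto simp: nbr_def)
next
  fix y assume "y \<in> F ` nbr E u"
  then obtain b where b: "b \<in> nbr E u" "y = F b" by auto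
  then have "b \<in> V" using graph_nbr_subset[OF gE] by auto
  then show "y \<in> nbr (image F ` E) (F u)"
    using b image_edge_iff[OF gE inj _ u, of b] by (simp add: nbr_def)
qed

lemma degree_image:
  assumes gE: "graph V E" and inj: "inj_on F V" and u: "u \<in> V"
  shows "degree (image F ` E) (F u) = degree E u"
proof -
  have "inj_on F (nbr E u)" using inj graph_nbr_subset[OF gE] by (rule inj_on_subset)
  then show ?thesis by (simp add: degree_nbr nbr_image[OF assms] card_image)
qed

lemma degree_image_outside:
  assumes gE: "graph V E" and y: "y \<notin> F ` V"
  shows "degree (image F ` E) y = 0"
proof -
  have "y \<notin> F ` e" if "e \<in> E" for e using gE that y by (auto simp: graph_def)
  then have "{u, y} \<notin> image F ` E" for u by blast
  then have "nbr (image F ` E) y = {}" by (simp add: nbr_def)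
  then show ?thesis by (simp add: degree_nbr)
qed

lemma degree_Un_le: "degree (G \<union> H) y \<le> degree G y + degree H y"
proof -
  have "nbr (G \<union> H) y = nbr G y \<union> nbr H y" by (auto simp: nbr_def)
  then show ?thesis by (simp add: degree_nbr card_Un_le)
qed

lemma graph_image:
  assumes gE: "graph V E" and inj: "inj_on F V" and V: "F ` V \<subseteq> N" and N: "finite N"
  shows "graph N (image F ` E)"
  unfolding graph_def
proof (intro conjI ballI N)
  fix e assume "e \<in> image F ` E"
  then obtain a b where ab: "e = {F a, F b}" "a \<noteq> b" "a \<in> V" "b \<in> V"
    using gE by (auto simp: graph_def)
  then have "F a \<noteq> F b" "F a \<in> N" "F b \<in> N" using V inj by (auto simp: inj_on_def)
  then show "\<exists>u v. e = {u, v} \<and> u \<noteq> v \<and> u \<in> N \<and> v \<in> N" using ab(1) by blast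
qed

text \<open>The state after packing \<open>j\<close> trees into \<open>G\<close>. The vertices \<open>j + 1, \<dots>, t\<close> are reserved
  as hubs of the remaining trees and have only hosted leaves so far. The only vertices of large
  degree are former hubs adjacent to all reserved ones; the remaining trees leave these out.\<close>

definition packing_state :: "nat \<Rightarrow> nat \<Rightarrow> nat \<Rightarrow> nat set set \<Rightarrow> bool" where
  "packing_state n t j G \<longleftrightarrow> graph {..<n} G \<and> card G \<le> j * n \<and>
     (\<forall>k\<in>{Suc j..t}. degree G k \<le> j \<and> (\<forall>l\<in>{Suc j..t}. {k, l} \<notin> G)) \<and>
     (\<forall>y<n. 2 * degree G y \<le> n + 162 * t + 4 * j \<or> (\<forall>k\<in>{Suc j..t}. {y, k} \<in> G))"

text \<open>The new tree omits exactly \<open>j\<close> vertices of the complete graph, and the next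
  hub \<open>c\<close> has at most \<open>j\<close> neighbours in \<open>G\<close>; so all of them
  can be omitted. Every vertex of excessive degree is adjacent to all reserved hubs, in particular
  to \<open>c\<close>, and is thereby omitted too.\<close>

lemma packing_step:
  assumes tr: "tree V E" and cV: "card V = n - Suc j + 1" and j: "j < t"
    and conds: "cond1 n V E \<or> cond2 n V E"
    and state: "packing_state n t j G"
    and m: "m = real n powr (1/3)" "4 * real t \<le> m" "m \<le> 400 * real t" "401 * real t + 1 \<le> m\<^sup>2"
    and few_anchors: "\<forall>k. m / 41 \<le> real k + 1 \<longrightarrow> real n * 2 ^ 81 * (5/6) ^ k < 1"
    and many_anchors: "real n * 2 ^ (80 * t + 1) * (5/6) ^ (400 * t) < 1"
    and K: "n \<le> K * K" "100 * ((401 * t + 2 * K + 1) * (40 * t + 1)) \<le> n"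
  shows "\<exists>F. inj_on F V \<and> F ` V \<subseteq> {..<n} \<and> (image F ` E) \<inter> G = {} \<and>
     packing_state n t (Suc j) (G \<union> image F ` E)"
proof -
  have gE: "graph V E" and fV: "finite V" using tr by (auto simp: tree_def graph_def)
  have gG: "graph {..<n} G" and cG: "card G \<le> j * n"
    and res: "\<And>k. k \<in> {Suc j..t} \<Longrightarrow> degree G k \<le> j"
    and resind: "\<And>k l. k \<in> {Suc j..t} \<Longrightarrow> l \<in> {Suc j..t} \<Longrightarrow> {k, l} \<notin> G"
    and big: "\<And>y. y < n \<Longrightarrow> 2 * degree G y \<le> n + 162 * t + 4 * j \<or> (\<forall>k\<in>{Suc j..t}. {y, k} \<in> G)"
    using state unfolding packing_state_def by blast+
  have t1: "t \<ge> 1" using j by simp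
  define Z where "Z = (401 * t + 2 * K + 1) * (40 * t + 1)"
  have "401 * t + 1 \<le> Z" "100 * Z \<le> n" using K(2) by (simp_all add: Z_def algebra_simps)
  then have tn: "401 * t + 1 \<le> n" by linarith
  have "t < n" using tn by simp
  moreover from this have "card V = n - j" using cV j by simp
  ultimately have tn': "t < n" "3 \<le> card V" "card V \<le> n" "n \<le> card V + t"
    using tn j by simp_all
  define c where "c = Suc j"
  define D where "D = {Suc (Suc j)..t}"
  have cD: "{Suc j..t} = insert c D" using j by (auto simp: c_def D_def)
  have card_rest: "card ({..<n} - {Suc j..t}) \<ge> j"
  proof -
    have "card ({..<n} - {Suc j..t}) \<ge> card {..<n} - card {Suc j..t}"
      by (intro diff_card_le_card_Diff) simp
    then show ?thesis using tn' j by simp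
  qed
  have "nbr G c \<subseteq> {..<n} - {Suc j..t}"
  proof
    fix x assume x: "x \<in> nbr G c"
    then have "{x, c} \<in> G" by (simp add: nbr_def)
    then have "x \<notin> {Suc j..t}" using resind[of x c] cD by blast
    then show "x \<in> {..<n} - {Suc j..t}" using x graph_nbr_subset[OF gG, of c] by blast
  qed
  moreover have "card (nbr G c) \<le> j" using res[of c] cD by (simp add: degree_nbr)
  \<comment> \<open>The neighbours of \<open>c\<close> are padded to exactly \<open>j\<close>
    vertices outside the reserved range, so that the later hubs remain available for the leaves
    \<open>\<Lambda>\<close>.\<close>
  ultimately obtain Om where Om: "nbr G c \<subseteq> Om" "Om \<subseteq> {..<n} - {Suc j..t}" "card Om = j"
    using exists_subset_between[of "nbr G c" j "{..<n} - {Suc j..t}"] card_rest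
    by (metis finite_Diff finite_lessThan)
  have fOm: "finite Om" using Om(2) finite_subset by blast
  define W where "W = {..<n} - Om - {c}"
  have cn: "c < n" "c \<notin> Om" using Om(2) cD tn'(1) j unfolding c_def by auto
  have cW: "card W + 1 = card V"
  proof -
    have "card ({..<n} - Om) = n - j" using Om(2,3) fOm by (subst card_Diff_subset) auto
    then have "card W = n - j - 1" using cn unfolding W_def by (subst card_Diff_singleton) auto
    then show ?thesis using cV tn' j by simp
  qed
  have W: "W \<subseteq> {..<n}" "c \<notin> W" by (auto simp: W_def)
  have cfree: "{c, x} \<notin> G" if "x \<in> W" for x
    using that Om(1) by (auto simp: W_def nbr_def insert_commute)
  have cGt: "card G \<le> t * n" using cG j mult_le_mono1[of j t n] by linarith
  have degW: "2 * degree G y \<le> n + 250 * t" if y: "y \<in> W" for y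
  proof -
    have "{y, c} \<notin> G" using cfree[OF y] by (simp add: insert_commute)
    then have "2 * degree G y \<le> n + 162 * t + 4 * j" using big[of y] y W(1) cD by blast
    then show ?thesis using j by simp
  qed
  have DW: "D \<subseteq> W"
  proof
    fix x assume x: "x \<in> D"
    then have "x \<notin> Om" using Om(2) cD by blast
    moreover have "x < n" "x \<noteq> c" using x tn'(1) by (auto simp: D_def c_def)
    ultimately show "x \<in> W" by (simp add: W_def)
  qed
  have Dt: "card D \<le> t" by (simp add: D_def)
  have Ddeg: "degree G x \<le> t" if "x \<in> D" for x using res[of x] cD that j by simp
  obtain v \<Lambda> P where v: "v \<in> V" "\<not> leaf V E v"
    and \<Lambda>: "\<Lambda> \<subseteq> {w. leaf V E w}" "card \<Lambda> = card D"
    and P: "P \<subseteq> V - {v}" "\<forall>p\<in>P. \<not> leaf V E p" "card P \<le> 400 * t"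
    and anchors: "81 * t \<le> card (leaf_nbrs V E v - \<Lambda>) \<or>
      (\<exists>g h. (\<forall>p\<in>P. g \<le> card (leaf_nbrs V E p - \<Lambda>)) \<and> 80 * t < h * g \<and>
         real n * 2 ^ h * (5/6) ^ card P < 1)"
    and degV: "\<forall>u\<in>V - {v}. 2 * degree E u \<le> n + 82 * t"
    and degv: "2 * degree E v \<le> n + 82 * t \<or> \<Lambda> \<subseteq> nbr E v"
    using hub_selection[OF tr tn'(2,3) Dt t1 m few_anchors many_anchors conds]
    by (elim exE conjE) (rule that)
  have P2: "\<not> leaf V E p" if "p \<in> P" for p using P(2) that by blast
  have "\<exists>F. emb E G V F \<and> F v = c \<and> F ` (V - {v}) = W \<and> F ` \<Lambda> = D \<and>
     (\<forall>u\<in>V - {v}. degree G (F u) \<le> 40 * t \<or> degree E u \<le> 2)"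
    by (rule anchored_embedding[OF tr gG v W cW cfree cGt t1 degW DW Dt Ddeg \<Lambda> P(1) P2 P(3) anchors K tn'(3,4)])
  then obtain F where F: "emb E G V F" "F v = c" "F ` (V - {v}) = W" "F ` \<Lambda> = D"
     "\<forall>u\<in>V - {v}. degree G (F u) \<le> 40 * t \<or> degree E u \<le> 2"
    by blast
  have inj: "inj_on F V" using F(1) by (simp add: emb_def)
  let ?H = "image F ` E"
  have FV: "F ` V = insert c W" using F(2,3) v(1) by auto
  have FVn: "F ` V \<subseteq> {..<n}" using FV W(1) cn by auto
  have disj: "?H \<inter> G = {}"
  proof -
    have "F ` e \<notin> G" if e: "e \<in> E" for e
    proof -
      obtain a b where "e = {a, b}" "a \<in> V" "b \<in> V" using e gE by (auto simp: graph_def)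
      then show ?thesis using F(1) e by (simp add: emb_def)
    qed
    then show ?thesis by auto
  qed
  have gH: "graph {..<n} ?H" using graph_image[OF gE inj FVn] by simp
  have g': "graph {..<n} (G \<union> ?H)" using gG gH by (auto simp: graph_def)
  have "card ?H \<le> card E" using graph_finite_edges[OF gE] by (rule card_image_le)
  moreover have "card E + 1 \<le> card V" using tr by (intro acyclic_card_edges) (auto simp: tree_def)
  ultimately have "card ?H \<le> n" using tn' by linarith
  then have card': "card (G \<union> ?H) \<le> Suc j * n" using cG card_Un_le[of G ?H] by simp
  have res': "degree (G \<union> ?H) k \<le> Suc j" "{k, l} \<notin> G \<union> ?H" if kl: "k \<in> D" "l \<in> D" for k l
  proof -
    obtain a b where ab: "a \<in> \<Lambda>" "k = F a" "b \<in> \<Lambda>" "l = F b" using kl F(4) by blast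
    have abV: "a \<in> V" "b \<in> V" "leaf V E a" "leaf V E b" using ab \<Lambda>(1) by (auto simp: leaf_def)
    have "degree ?H k = 1" using degree_image[OF gE inj abV(1)] abV(3) ab(2) by (simp add: leaf_def)
    then show "degree (G \<union> ?H) k \<le> Suc j"
      using degree_Un_le[of G ?H k] res[of k] kl(1) cD by simp
    have "{k, l} \<notin> ?H"
      using image_edge_iff[OF gE inj abV(1,2)] tree_leaves_nonadjacent[OF tr tn'(2) abV(3,4)] ab by simp
    then show "{k, l} \<notin> G \<union> ?H" using resind[of k l] kl cD by simp
  qed
  have big': "2 * degree (G \<union> ?H) y \<le> n + 162 * t + 4 * Suc j \<or> (\<forall>k\<in>D. {y, k} \<in> G \<union> ?H)"
    if y: "y < n" for y
  proof (cases "\<forall>k\<in>{Suc j..t}. {y, k} \<in> G")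
    case True
    then show ?thesis using cD by auto
  next
    case False
    then have dy: "2 * degree G y \<le> n + 162 * t + 4 * j" using big[OF y] by blast
    have sum: "2 * degree (G \<union> ?H) y \<le> 2 * degree G y + 2 * degree ?H y"
      using degree_Un_le[of G ?H y] by simp
    consider "y \<notin> F ` V" | "y = c" | "y \<in> W" using FV by blast
    then show ?thesis
    proof cases
      case 1
      then show ?thesis using degree_image_outside[OF gE 1] sum dy by simp
    next
      case 2
      have dc: "degree ?H c = degree E v" using degree_image[OF gE inj v(1)] F(2) by simp
      from degv show ?thesis
      proof
        assume "2 * degree E v \<le> n + 82 * t"
        then show ?thesis using sum dc 2 res[of c] cD j by simp
      next
        \<comment> \<open>The degree of \<open>c\<close> may now be large, but the leaves in
          \<open>\<Lambda>\<close> occupy exactly \<open>D\<close>, so \<open>c\<close> has become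
          adjacent to all hubs still reserved.\<close>
        assume sub: "\<Lambda> \<subseteq> nbr E v"
        have "{y, k} \<in> ?H" if "k \<in> D" for k
        proof -
          obtain a where a: "a \<in> \<Lambda>" "k = F a" using \<open>k \<in> D\<close> F(4) by blast
          then have "a \<in> V" "{v, a} \<in> E" using \<Lambda>(1) sub by (auto simp: leaf_def nbr_def insert_commute)
          then show ?thesis using image_edge_iff[OF gE inj v(1), of a] a 2 F(2) by simp
        qed
        then show ?thesis by blast
      qed
    next
      case 3
      then obtain u where u: "u \<in> V - {v}" "y = F u" using F(3) by blast
      have du: "degree ?H y = degree E u" using degree_image[OF gE inj, of u] u by simp
      \<comment> \<open>Either the old degree is at most \<open>40 * t\<close>, and doubling gives
        \<open>n + 82 * t + 80 * t\<close>, or the tree adds at most 2, which raises the doubled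
        degree by at most 4.\<close>
      have "2 * degree E u \<le> n + 82 * t" using degV u by blast
      moreover have "degree G y \<le> 40 * t \<or> degree E u \<le> 2" using F(5) u by blast
      ultimately have "2 * degree (G \<union> ?H) y \<le> n + 162 * t + 4 * Suc j"
        using sum du dy by (elim disjE) simp_all
      then show ?thesis by blast
    qed
  qed
  have "packing_state n t (Suc j) (G \<union> ?H)"
    unfolding packing_state_def D_def[symmetric] using g' card' res' big' by simp
  then show ?thesis using inj FVn disj by blast
qed

text \<open>This separates the combinatorics from the asymptotics: iterating the packing step
  requires only these inequalities between \<open>n\<close>, \<open>m\<close>, \<open>t\<close> and
  \<open>K\<close>.\<close>

lemma packs_into_K_of_numerics:
  assumes T: "\<And>i. i \<in> {1..t} \<Longrightarrow> tree (fst (T i)) (snd (T i)) \<and> card (fst (T i)) = n - i + 1 \<and>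
          (cond1 n (fst (T i)) (snd (T i)) \<or> cond2 n (fst (T i)) (snd (T i)))"
    and m: "m = real n powr (1/3)" "4 * real t \<le> m" "m \<le> 400 * real t" "401 * real t + 1 \<le> m\<^sup>2"
    and few_anchors: "\<forall>k. m / 41 \<le> real k + 1 \<longrightarrow> real n * 2 ^ 81 * (5/6) ^ k < 1"
    and many_anchors: "real n * 2 ^ (80 * t + 1) * (5/6) ^ (400 * t) < 1"
    and K: "n \<le> K * K" "100 * ((401 * t + 2 * K + 1) * (40 * t + 1)) \<le> n"
  shows "packs_into_K n T {1..t}"
proof -
  have "\<exists>f. (\<forall>i\<in>{1..j}. inj_on (f i) (fst (T i)) \<and> f i ` fst (T i) \<subseteq> {..<n}) \<and>
      (\<forall>i\<in>{1..j}. \<forall>k\<in>{1..j}. i \<noteq> k \<longrightarrow> (image (f i) ` snd (T i)) \<inter> (image (f k) ` snd (T k)) = {}) \<and>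
      packing_state n t j (\<Union>i\<in>{1..j}. image (f i) ` snd (T i))" if "j \<le> t" for j
    using that
  proof (induction j)
    case 0
    have "packing_state n t 0 {}" by (auto simp: packing_state_def graph_def degree_def)
    then show ?case by simp
  next
    case (Suc j)
    obtain f where f1: "\<forall>i\<in>{1..j}. inj_on (f i) (fst (T i)) \<and> f i ` fst (T i) \<subseteq> {..<n}"
      and f2: "\<forall>i\<in>{1..j}. \<forall>k\<in>{1..j}. i \<noteq> k \<longrightarrow>
        (image (f i) ` snd (T i)) \<inter> (image (f k) ` snd (T k)) = {}"
      and f3: "packing_state n t j (\<Union>i\<in>{1..j}. image (f i) ` snd (T i))"
      using Suc.IH[OF Suc_leD[OF Suc.prems]] by (elim exE conjE) (rule that)
    have j: "Suc j \<in> {1..t}" "j < t" using Suc.prems by auto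
    let ?G = "\<Union>i\<in>{1..j}. image (f i) ` snd (T i)"
    have Tj: "tree (fst (T (Suc j))) (snd (T (Suc j)))" "card (fst (T (Suc j))) = n - Suc j + 1"
      "cond1 n (fst (T (Suc j))) (snd (T (Suc j))) \<or> cond2 n (fst (T (Suc j))) (snd (T (Suc j)))"
      using T[OF j(1)] by simp_all
    obtain F where F: "inj_on F (fst (T (Suc j)))" "F ` fst (T (Suc j)) \<subseteq> {..<n}"
      "(image F ` snd (T (Suc j))) \<inter> ?G = {}"
      "packing_state n t (Suc j) (?G \<union> image F ` snd (T (Suc j)))"
      using packing_step[OF Tj(1,2) j(2) Tj(3) f3 m few_anchors many_anchors K]
      by (elim exE conjE) (rule that)
    define f' where "f' = f(Suc j := F)"
    have old: "f' i = f i" if "i \<in> {1..j}" for i using that by (auto simp: f'_def)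
    have new: "f' (Suc j) = F" by (simp add: f'_def)
    have set: "{1..Suc j} = insert (Suc j) {1..j}" by auto
    have "(\<Union>i\<in>{1..Suc j}. image (f' i) ` snd (T i)) = ?G \<union> image F ` snd (T (Suc j))"
      unfolding set by (simp add: old new Un_commute)
    then have st: "packing_state n t (Suc j) (\<Union>i\<in>{1..Suc j}. image (f' i) ` snd (T i))" using F(4) by simp
    have embs: "\<forall>i\<in>{1..Suc j}. inj_on (f' i) (fst (T i)) \<and> f' i ` fst (T i) \<subseteq> {..<n}"
      unfolding set using f1 old new F(1,2) by simp
    have newdisj: "(image F ` snd (T (Suc j))) \<inter> (image (f i) ` snd (T i)) = {}"
      if "i \<in> {1..j}" for i
      using F(3) that by blast
    have disj: "(image (f' i) ` snd (T i)) \<inter> (image (f' k) ` snd (T k)) = {}"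
      if ik: "i \<in> {1..Suc j}" "k \<in> {1..Suc j}" "i \<noteq> k" for i k
    proof -
      consider "i \<in> {1..j}" "k \<in> {1..j}" | "i = Suc j" "k \<in> {1..j}" | "i \<in> {1..j}" "k = Suc j"
        using ik unfolding set by blast
      then show ?thesis
      proof cases
        case 1
        then show ?thesis using f2 ik(3) old by simp
      next
        case 2
        then show ?thesis using newdisj[OF 2(2)] old[OF 2(2)] new by simp
      next
        case 3
        then show ?thesis using newdisj[OF 3(1)] old[OF 3(1)] new by (simp add: Int_commute)
      qed
    qed
    show ?case
    proof (intro exI[of _ f'] conjI)
      show "\<forall>i\<in>{1..Suc j}. \<forall>k\<in>{1..Suc j}. i \<noteq> k \<longrightarrow>
          (image (f' i) ` snd (T i)) \<inter> (image (f' k) ` snd (T k)) = {}" using disj by simp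
    qed (fact embs st)+
  qed
  from this[OF order_refl] show ?thesis
    unfolding packs_into_K_def by (elim exE conjE) (intro exI conjI)
qed

section \<open>Choice of the parameters for large \<open>n\<close>\<close>

theorem theorem3:
  shows "\<exists>n0::nat. \<forall>n\<ge>n0. \<forall>T :: nat \<Rightarrow> nat set \<times> nat set set.
     (let t = nat \<lfloor>real n powr (1/3) / 4\<rfloor> in
       (\<forall>i\<in>{1..t}. tree (fst (T i)) (snd (T i)) \<and> card (fst (T i)) = n - i + 1 \<and>
          (cond1 n (fst (T i)) (snd (T i)) \<or> cond2 n (fst (T i)) (snd (T i))))
       \<longrightarrow> packs_into_K n T {1..t})"
proof -
  have "\<forall>\<^sub>F n in sequentially. 200 \<le> real n powr (1/3)" by real_asymp
  moreover have "\<forall>\<^sub>F n in sequentially.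
      real n * 2 ^ 81 * (5/6) powr (real n powr (1/3) / 41 - 1) < 1" by real_asymp
  moreover have "\<forall>\<^sub>F n in sequentially.
      2 * real n * (1/2) powr (real n powr (1/3) / 4 - 1) < 1" by real_asymp
  moreover have "\<forall>\<^sub>F n in sequentially.
      100 * ((401 * (real n powr (1/3) / 4) + 2 * (sqrt (real n) + 1) + 1)
        * (40 * (real n powr (1/3) / 4) + 1)) \<le> real n" by real_asymp
  ultimately have "\<forall>\<^sub>F n in sequentially. \<forall>T :: nat \<Rightarrow> nat set \<times> nat set set.
     (let t = nat \<lfloor>real n powr (1/3) / 4\<rfloor> in
       (\<forall>i\<in>{1..t}. tree (fst (T i)) (snd (T i)) \<and> card (fst (T i)) = n - i + 1 \<and>
          (cond1 n (fst (T i)) (snd (T i)) \<or> cond2 n (fst (T i)) (snd (T i))))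
       \<longrightarrow> packs_into_K n T {1..t})"
  proof eventually_elim
    case (elim n)
    \<comment> \<open>Rounding enters only through \<open>t\<close>, which lies between
      \<open>m / 4 - 1\<close> and \<open>m / 4\<close>, and \<open>K\<close>, which lies between
      \<open>sqrt n\<close> and \<open>sqrt n + 1\<close>; the four asymptotic estimates are phrased
      with these real bounds.\<close>
    define m where "m = real n powr (1/3)"
    define t where "t = nat \<lfloor>m / 4\<rfloor>"
    define K where "K = nat \<lceil>sqrt (real n)\<rceil>"
    have m200: "200 \<le> m" using elim(1) by (simp add: m_def)
    have t_le: "real t \<le> m / 4" and t_ge: "m / 4 - 1 \<le> real t"
      using m200 unfolding t_def by linarith+
    have K_ge: "sqrt (real n) \<le> real K" and K_le: "real K \<le> sqrt (real n) + 1"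
      unfolding K_def by (simp_all add: real_nat_ceiling_ge)
    have m4: "401 * real t + 1 \<le> m\<^sup>2"
    proof -
      have "401 * real t + 1 \<le> 200 * m" using t_le m200 by linarith
      also have "\<dots> \<le> m\<^sup>2" using m200 by (simp add: power2_eq_square)
      finally show ?thesis .
    qed
    have few: "\<forall>k. m / 41 \<le> real k + 1 \<longrightarrow> real n * 2 ^ 81 * (5/6) ^ k < 1"
    proof (intro allI impI)
      fix k assume k: "m / 41 \<le> real k + 1"
      have "(5/6::real) ^ k = (5/6) powr real k" by (simp add: powr_realpow)
      also have "\<dots> \<le> (5/6) powr (m / 41 - 1)" using k by (intro powr_mono') auto
      finally have "real n * 2 ^ 81 * (5/6) ^ k \<le> real n * 2 ^ 81 * (5/6) powr (m / 41 - 1)"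
        by (intro mult_left_mono) auto
      then show "real n * 2 ^ 81 * (5/6) ^ k < 1" using elim(2) unfolding m_def by linarith
    qed
    have many: "real n * 2 ^ (80 * t + 1) * (5/6) ^ (400 * t) < 1"
    proof -
      \<comment> \<open>There are five anchors for each factor 2, and \<open>2 * (5/6) ^ 5\<close>
        is about 0.804, hence below 1; already its fourth power, about 0.417, is below
        \<open>1/2\<close>.\<close>
      have "(2::real) ^ (80 * t) * (5/6) ^ (400 * t) = ((2 * (5/6) ^ 5) ^ 80) ^ t"
      proof -
        have "400 * t = 5 * (80 * t)" by simp
        then show ?thesis by (simp only: power_mult power_mult_distrib)
      qed
      also have "\<dots> \<le> (1/2) ^ t"
      proof (rule power_mono)
        have "(2 * (5/6) ^ 5 :: real) ^ 80 \<le> (2 * (5/6) ^ 5) ^ 4"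
          by (intro power_decreasing) (auto simp: power_divide)
        also have "\<dots> \<le> 1/2" by (simp add: power_divide)
        finally show "(2 * (5/6) ^ 5 :: real) ^ 80 \<le> 1/2" .
      qed simp
      also have "\<dots> = (1/2) powr real t" by (simp add: powr_realpow)
      also have "\<dots> \<le> (1/2) powr (m / 4 - 1)" using t_ge by (intro powr_mono') auto
      finally have "2 * real n * (2 ^ (80 * t) * (5/6) ^ (400 * t)) \<le> 2 * real n * (1/2) powr (m / 4 - 1)"
        by (intro mult_left_mono) auto
      then show ?thesis using elim(3) unfolding m_def by (simp add: mult_ac)
    qed
    have K1: "n \<le> K * K"
    proof -
      have "real n = sqrt (real n) * sqrt (real n)" by simp
      also have "\<dots> \<le> real K * real K" using K_ge by (intro mult_mono) auto
      finally show ?thesis by (metis of_nat_le_iff of_nat_mult)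
    qed
    have K2: "100 * ((401 * t + 2 * K + 1) * (40 * t + 1)) \<le> n"
    proof -
      have "real (100 * ((401 * t + 2 * K + 1) * (40 * t + 1)))
          = 100 * ((401 * real t + 2 * real K + 1) * (40 * real t + 1))"
        by (simp only: of_nat_mult of_nat_add of_nat_numeral of_nat_1)
      also have "\<dots> \<le> 100 * ((401 * (m / 4) + 2 * (sqrt (real n) + 1) + 1) * (40 * (m / 4) + 1))"
        using t_le K_le m200 by (intro mult_left_mono mult_mono) auto
      also have "\<dots> \<le> real n" using elim(4) by (simp add: m_def)
      finally show ?thesis by (simp only: of_nat_le_iff)
    qed
    have m23: "4 * real t \<le> m" "m \<le> 400 * real t" using t_le t_ge m200 by linarith+
    show ?case
      unfolding Let_def m_def[symmetric] t_def[symmetric]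
      by (intro allI impI packs_into_K_of_numerics[OF _ m_def m23 m4 few many K1 K2]) blast
  qed
  then show ?thesis by (simp only: eventually_sequentially)
qed

end
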